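(* Let $c\ge1$. Then the $c$-Schur property is preserved by arbitrary $\ell_1$-sums; that is, if $(X_i)_{i\in I}$ is an arbitrary family of Banach spaces each having the $c$-Schur property, then its $\ell_1$-sum has the $c$-Schur property.
   Context: Banach spaces are over a fixed field $\mathbb F\in\{\mathbb R,\mathbb C\}$. For a bounded sequence put $\operatorname{ca}(x_n)=\inf_{n}\operatorname{diam}\{x_k: k\ge n\}$ (also for scalar sequences) and $\delta(x_n)=\sup\{\operatorname{ca}(x^*(x_n)): x^*\in B_{X^*}\}$. A Banach space $X$ has the $c$-Schur property if $\operatorname{ca}(x_n)\le c\,\delta(x_n)$ for each bounded sequence $(x_n)$ in $X$. The $\ell_1$-sum of $(X_i)_{i\in I}$ is the space of families $(x_i)_{i\in I}$, $x_i\in X_i$, with norm $\sum_{i\in I}\|x_i\|<\infty$. *)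

theory Defs
  imports "HOL-Analysis.Analysis" "HOL-Algebra.Algebraic_Closure_Type"
begin

text \<open>
  Banach spaces are carrier-based, so that the members of a family may be completely
  unrelated spaces: all carriers are subsets of one type \<open>'a\<close>, but each space has its own
  operations and norm, and any family of sets embeds into a common type.
  The scalar field \<open>'k\<close> is meant to be instantiated with \<^typ>\<open>real\<close> or \<^typ>\<open>complex\<close>.
  A vector space over \<open>'k\<close> is a HOL-Algebra module over the field \<open>'k\<close>; the fields
  \<open>mult\<close> and \<open>one\<close>, which a module inherits from the underlying record type, are
  irrelevant.
\<close>

record ('k, 'a) normed_module = "('k, 'a) module" +
  nrm :: "'a \<Rightarrow> real"

locale normed_vector_space =
  Module.module "ring_of_type_algebra :: 'k::real_normed_field ring" V
  for V :: "('k::real_normed_field, 'a) normed_module" (structure) +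
  assumes nrm_eq_0_iff: "x \<in> carrier V \<Longrightarrow> nrm V x = 0 \<longleftrightarrow> x = \<zero>"
    and nrm_triangle: "\<lbrakk>x \<in> carrier V; y \<in> carrier V\<rbrakk> \<Longrightarrow> nrm V (x \<oplus> y) \<le> nrm V x + nrm V y"
    and nrm_smult: "x \<in> carrier V \<Longrightarrow> nrm V (a \<odot> x) = norm a * nrm V x"

text \<open>
  The library's \<^locale>\<open>Metric_space\<close> requires symmetry and nonnegativity also off the
  carrier; hence the default value 0.
\<close>

definition ndist :: "('k, 'a) normed_module \<Rightarrow> 'a \<Rightarrow> 'a \<Rightarrow> real" where
  "ndist V x y = (if x \<in> carrier V \<and> y \<in> carrier V then nrm V (x \<ominus>\<^bsub>V\<^esub> y) else 0)"

locale banach_space = normed_vector_space V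
  for V :: "('k::real_normed_field, 'a) normed_module" (structure) +
  assumes complete: "Metric_space.mcomplete (carrier V) (ndist V)"

definition bounded_seq :: "('k, 'a) normed_module \<Rightarrow> (nat \<Rightarrow> 'a) \<Rightarrow> bool" where
  "bounded_seq V s \<longleftrightarrow> range s \<subseteq> carrier V \<and> bdd_above (range (\<lambda>n. nrm V (s n)))"

text \<open>
  The quantity \<open>ca\<close> takes the distance function as an argument, as it is used both for
  vectors (with \<^const>\<open>ndist\<close>) and for scalars (with \<^const>\<open>dist\<close>). The real-valued
  suprema and infima here and below are genuine only for bounded sequences.
\<close>

definition ca :: "('b \<Rightarrow> 'b \<Rightarrow> real) \<Rightarrow> (nat \<Rightarrow> 'b) \<Rightarrow> real" where
  "ca d s = (INF n. SUP (x, y)\<in>(s ` {n..}) \<times> (s ` {n..}). d x y)"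

lemma ca_dist_eq_diameter: "ca dist s = (INF n. diameter (s ` {n..}))"
  by (simp add: ca_def diameter_def)

text \<open>
  Values of functionals outside the carrier are irrelevant and left unconstrained.
\<close>

definition dual :: "('k::real_normed_field, 'a) normed_module \<Rightarrow> ('a \<Rightarrow> 'k) set" where
  "dual V = {f. (\<forall>x\<in>carrier V. \<forall>y\<in>carrier V. f (x \<oplus>\<^bsub>V\<^esub> y) = f x + f y) \<and>
                (\<forall>a. \<forall>x\<in>carrier V. f (a \<odot>\<^bsub>V\<^esub> x) = a * f x) \<and>
                (\<exists>C. \<forall>x\<in>carrier V. norm (f x) \<le> C * nrm V x)}"

definition dual_norm :: "('k::real_normed_field, 'a) normed_module \<Rightarrow> ('a \<Rightarrow> 'k) \<Rightarrow> real" where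
  "dual_norm V f = (SUP x\<in>{x \<in> carrier V. nrm V x \<le> 1}. norm (f x))"

definition dual_ball :: "('k::real_normed_field, 'a) normed_module \<Rightarrow> ('a \<Rightarrow> 'k) set" where
  "dual_ball V = {f \<in> dual V. dual_norm V f \<le> 1}"

definition delta :: "('k::real_normed_field, 'a) normed_module \<Rightarrow> (nat \<Rightarrow> 'a) \<Rightarrow> real" where
  "delta V s = (SUP f\<in>dual_ball V. ca dist (\<lambda>n. f (s n)))"

definition Schur_property :: "real \<Rightarrow> ('k::real_normed_field, 'a) normed_module \<Rightarrow> bool" where
  "Schur_property c V \<longleftrightarrow>
     banach_space V \<and> (\<forall>s. bounded_seq V s \<longrightarrow> ca (ndist V) s \<le> c * delta V s)"

definition l1_sum :: "'i set \<Rightarrow> ('i \<Rightarrow> ('k, 'a) normed_module) \<Rightarrow> ('k, 'i \<Rightarrow> 'a) normed_module" where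
  "l1_sum I V =
    \<lparr>carrier = {x \<in> (\<Pi>\<^sub>E i\<in>I. carrier (V i)). (\<lambda>i. nrm (V i) (x i)) summable_on I},
     monoid.mult = undefined,
     one = undefined,
     ring.zero = (\<lambda>i\<in>I. \<zero>\<^bsub>V i\<^esub>),
     add = (\<lambda>x y. \<lambda>i\<in>I. x i \<oplus>\<^bsub>V i\<^esub> y i),
     smult = (\<lambda>a x. \<lambda>i\<in>I. a \<odot>\<^bsub>V i\<^esub> x i),
     nrm = (\<lambda>x. \<Sum>\<^sub>\<infinity>i\<in>I. nrm (V i) (x i))\<rparr>"

end

theory Submission
  imports Defs
begin

text \<open>
  The proof passes through a reformulation of the c-Schur property that is stable under
  subsequences: for each bounded sequence \<open>u\<close> and each \<open>e > 0\<close> some functional \<open>f\<close> in the dual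
  ball satisfies \<open>\<bar>f (u n) - \<parallel>u n\<parallel> / c\<bar> \<le> e\<close> along a subsequence (\<open>aligned_norming\<close>). The c-Schur
  property implies this: pass to a subsequence with convergent norms, apply the property to the sequence \<open>u 0, - u 0, u 1, - u 1, \<dots>\<close>, whose
  \<open>ca\<close> is at least \<open>2 lim \<parallel>u n\<parallel>\<close>, extract a convergent subsequence of the scalars \<open>f (u n)\<close>, and
  rescale \<open>f\<close> (\<open>Schur_imp_aligned_norming\<close>). Conversely, in a Banach space it suffices to
  consider differences \<open>x k - x l\<close> whose norms nearly realise \<open>ca x\<close>
  (\<open>aligned_norming_imp_Schur\<close>). Since the values of \<open>f\<close> are close to nonnegative reals, functionals
  on different coordinates add up without cancellation.

  Let \<open>u\<close> be a bounded sequence in the l1-sum. After passing to a subsequence there is a finite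
  set \<open>F\<close> of coordinates such that every finite set of further coordinates eventually carries
  little mass (\<open>essential_finite_part\<close>): choose \<open>F\<close> and the subsequence so that the mass outside
  \<open>F\<close> is nearly minimal. A gliding hump outside \<open>F\<close> then yields a further subsequence
  and disjoint finite sets \<open>G k\<close> such that the \<open>k\<close>-th term is nearly supported in \<open>F \<union> G k\<close>
  (\<open>gliding_hump\<close>). On \<open>F\<close> the functionals come from finitely many successive applications of
  \<open>aligned_norming\<close> (\<open>aligned_norming_finite\<close>). On \<open>G k\<close> only the single \<open>k\<close>-th term matters, and
  \<open>aligned_norming\<close> for constant sequences supplies functionals that norm it up to the factor \<open>c\<close>;
  thus the Hahn-Banach theorem is not needed. The coordinate functionals
  together form one functional in the dual ball of the l1-sum
  (\<open>l1_functional_in_dual_ball\<close>), which proves \<open>aligned_norming\<close> for the l1-sum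
  (\<open>aligned_norming_l1_sum\<close>).
\<close>

section \<open>Normed spaces and their dual balls\<close>

text \<open>Scalar arithmetic in the module is arithmetic of the type \<open>'k\<close>.\<close>

lemma type_algebra_simps [simp]:
  "carrier (ring_of_type_algebra :: 'k::real_normed_field ring) = UNIV"
  "\<zero>\<^bsub>(ring_of_type_algebra :: 'k ring)\<^esub> = 0"
  "\<one>\<^bsub>(ring_of_type_algebra :: 'k ring)\<^esub> = 1"
  "a \<oplus>\<^bsub>(ring_of_type_algebra :: 'k ring)\<^esub> b = a + b"
  "a \<otimes>\<^bsub>(ring_of_type_algebra :: 'k ring)\<^esub> b = a * b"
  by (simp_all add: ring_of_type_algebra_def)

context normed_vector_space
begin

lemma scale_closed [simp, intro]: "x \<in> carrier V \<Longrightarrow> a \<odot> x \<in> carrier V"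
  by (rule smult_closed) auto

lemma scale_zero_left: "x \<in> carrier V \<Longrightarrow> 0 \<odot> x = \<zero>"
  using smult_l_null[of x] by simp

lemma scale_one_left: "x \<in> carrier V \<Longrightarrow> 1 \<odot> x = x"
  using smult_one[of x] by simp

lemma scale_minus_one:
  assumes x: "x \<in> carrier V"
  shows "(-1) \<odot> x = \<ominus> x"
proof -
  have "(-1) \<odot> x \<oplus> x = ((-1) + 1) \<odot> x"
    using smult_l_distr[of "-1" 1 x] x by (simp add: scale_one_left)
  also have "\<dots> = \<zero>" using x by (simp add: scale_zero_left)
  finally show ?thesis using x M.minus_equality[of "(-1) \<odot> x" x] by simp
qed

lemma nrm_zero [simp]: "nrm V \<zero> = 0"
  using nrm_eq_0_iff[of \<zero>] by simp

lemma nrm_minus: "x \<in> carrier V \<Longrightarrow> nrm V (\<ominus> x) = nrm V x"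
  using nrm_smult[of x "-1"] by (simp add: scale_minus_one)

lemma nrm_nonneg:
  assumes x: "x \<in> carrier V"
  shows "0 \<le> nrm V x"
proof -
  have "nrm V (x \<oplus> \<ominus> x) \<le> nrm V x + nrm V (\<ominus> x)" using x by (intro nrm_triangle) auto
  then show ?thesis using x by (simp add: nrm_minus M.r_neg)
qed

lemma nrm_diff_le:
  assumes "x \<in> carrier V" "y \<in> carrier V"
  shows "nrm V (x \<ominus> y) \<le> nrm V x + nrm V y"
  using nrm_triangle[of x "\<ominus> y"] assms by (simp add: nrm_minus a_minus_def)

lemma ndist_eq: "x \<in> carrier V \<Longrightarrow> y \<in> carrier V \<Longrightarrow> ndist V x y = nrm V (x \<ominus> y)"
  by (simp add: ndist_def)

lemma Metric_space_ndist: "Metric_space (carrier V) (ndist V)"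
proof
  fix x y
  show "0 \<le> ndist V x y" by (simp add: ndist_def nrm_nonneg)
  show "ndist V x y = ndist V y x"
  proof (cases "x \<in> carrier V \<and> y \<in> carrier V")
    case True
    then have "y \<ominus> x = \<ominus> (x \<ominus> y)" by (simp add: a_minus_def M.minus_add M.a_comm)
    with True show ?thesis by (simp add: ndist_eq nrm_minus)
  qed (auto simp: ndist_def)
next
  fix x y assume xy: "x \<in> carrier V" "y \<in> carrier V"
  have "x = x \<ominus> y \<oplus> y" using xy by (simp add: a_minus_def M.a_assoc M.l_neg)
  then have "x \<ominus> y = \<zero> \<longleftrightarrow> x = y" using xy by (auto simp: a_minus_def M.r_neg)
  then show "(ndist V x y = 0) = (x = y)" using xy by (simp add: ndist_eq nrm_eq_0_iff)
next
  fix x y z assume "x \<in> carrier V" "y \<in> carrier V" "z \<in> carrier V"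
  moreover from this have "x \<ominus> z = (x \<ominus> y) \<oplus> (y \<ominus> z)"
    by (simp add: a_minus_def M.a_assoc M.r_neg1 )
  ultimately show "ndist V x z \<le> ndist V x y + ndist V y z"
    using nrm_triangle[of "x \<ominus> y" "y \<ominus> z"] by (simp add: ndist_eq)
qed

lemma dual_ballI:
  assumes add: "\<And>x y. x \<in> carrier V \<Longrightarrow> y \<in> carrier V \<Longrightarrow> f (x \<oplus> y) = f x + f y"
    and scale: "\<And>a x. x \<in> carrier V \<Longrightarrow> f (a \<odot> x) = a * f x"
    and le: "\<And>x. x \<in> carrier V \<Longrightarrow> norm (f x) \<le> nrm V x"
  shows "f \<in> dual_ball V"
proof -
  have "f \<in> dual V"
    unfolding dual_def using assms by (auto intro!: exI[of _ 1])
  moreover have "dual_norm V f \<le> 1"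
    unfolding dual_norm_def
  proof (rule cSUP_least)
    show "{x \<in> carrier V. nrm V x \<le> 1} \<noteq> {}" by (auto intro!: exI[of _ \<zero>])
  qed (use le in force)
  ultimately show ?thesis by (simp add: dual_ball_def)
qed

lemma dual_ball_add:
  "f \<in> dual_ball V \<Longrightarrow> x \<in> carrier V \<Longrightarrow> y \<in> carrier V \<Longrightarrow> f (x \<oplus> y) = f x + f y"
  by (simp add: dual_ball_def dual_def)

lemma dual_ball_scale: "f \<in> dual_ball V \<Longrightarrow> x \<in> carrier V \<Longrightarrow> f (a \<odot> x) = a * f x"
  by (simp add: dual_ball_def dual_def)

lemma dual_ball_minus: "f \<in> dual_ball V \<Longrightarrow> x \<in> carrier V \<Longrightarrow> f (\<ominus> x) = - f x"
  using dual_ball_scale[of f x "-1"] by (simp add: scale_minus_one)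

lemma dual_ball_diff:
  "f \<in> dual_ball V \<Longrightarrow> x \<in> carrier V \<Longrightarrow> y \<in> carrier V \<Longrightarrow> f (x \<ominus> y) = f x - f y"
  using dual_ball_add[of f x "\<ominus> y"] by (simp add: dual_ball_minus a_minus_def)

text \<open>
  Together with \<open>dual_ballI\<close> this describes the dual ball pointwise. The supremum that defines the
  dual norm is genuine because functionals in the dual are bounded.
\<close>

lemma dual_ball_le:
  assumes f: "f \<in> dual_ball V" and x: "x \<in> carrier V"
  shows "norm (f x) \<le> nrm V x"
proof (cases "nrm V x = 0")
  case True
  then show ?thesis
    using f x dual_ball_scale[of f x 0] by (simp add: nrm_eq_0_iff scale_zero_left)
next
  case False
  then have pos: "nrm V x > 0" using nrm_nonneg[OF x] by simp
  obtain C where C: "\<And>y. y \<in> carrier V \<Longrightarrow> norm (f y) \<le> C * nrm V y"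
    using f unfolding dual_ball_def dual_def by blast
  have "bdd_above ((\<lambda>y. norm (f y)) ` {y \<in> carrier V. nrm V y \<le> 1})"
  proof (rule bdd_aboveI2)
    fix y assume "y \<in> {y \<in> carrier V. nrm V y \<le> 1}"
    then have "norm (f y) \<le> C * nrm V y" "0 \<le> nrm V y" "nrm V y \<le> 1"
      using C nrm_nonneg by auto
    then show "norm (f y) \<le> \<bar>C\<bar>"
      by (smt (verit) mult_left_le mult_right_mono)
  qed
  moreover have "of_real (1 / nrm V x) \<odot> x \<in> {y \<in> carrier V. nrm V y \<le> 1}"
    using x pos by (simp add: nrm_smult norm_divide)
  ultimately have "norm (f (of_real (1 / nrm V x) \<odot> x)) \<le> dual_norm V f"
    unfolding dual_norm_def by (rule cSUP_upper2[OF _ _ order_refl])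
  then have "norm (f (of_real (1 / nrm V x) \<odot> x)) \<le> 1"
    using f by (simp add: dual_ball_def)
  then show ?thesis
    using pos by (simp add: dual_ball_scale[OF f x] norm_mult norm_divide divide_le_eq)
qed

lemma zero_in_dual_ball: "(\<lambda>x. 0) \<in> dual_ball V"
  by (rule dual_ballI) (auto simp: nrm_nonneg)

lemma scale_in_dual_ball:
  assumes f: "f \<in> dual_ball V" and a: "norm a \<le> 1"
  shows "(\<lambda>x. a * f x) \<in> dual_ball V"
proof (rule dual_ballI)
  fix x assume x: "x \<in> carrier V"
  have "norm a * norm (f x) \<le> 1 * nrm V x"
    using a dual_ball_le[OF f x] by (intro mult_mono) auto
  then show "norm (a * f x) \<le> nrm V x" by (simp add: norm_mult)
qed (simp_all add: dual_ball_add[OF f] dual_ball_scale[OF f] distrib_left)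

lemma bounded_seqE:
  assumes "bounded_seq V s"
  obtains B where "B > 0" "\<And>n. s n \<in> carrier V" "\<And>n. nrm V (s n) \<le> B"
proof -
  from assms obtain B where "\<And>n. s n \<in> carrier V" "\<And>n. nrm V (s n) \<le> B"
    by (auto simp: bounded_seq_def bdd_above_def)
  moreover from this have "nrm V (s n) \<le> max B 1" for n by (smt (verit) max.cobounded1)
  ultimately show ?thesis by (intro that[of "max B 1"]) auto
qed

lemma bounded_seqI:
  assumes "\<And>n. s n \<in> carrier V" "\<And>n. nrm V (s n) \<le> B"
  shows "bounded_seq V s"
  using assms by (auto simp: bounded_seq_def bdd_above_def)

end


section \<open>The quantities ca and delta\<close>

text \<open>
  The distances along the sequence are assumed to be bounded throughout, so that all suprema
  involved are genuine.
\<close>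

lemma ca_ge:
  assumes bd: "\<And>m n. d (s m) (s n) \<le> B"
    and ex: "\<And>N. \<exists>k\<ge>N. \<exists>l\<ge>N. r \<le> d (s k) (s l)"
  shows "r \<le> ca d s"
  unfolding ca_def
proof (rule cINF_greatest)
  fix N :: nat
  obtain k l where kl: "k \<ge> N" "l \<ge> N" "r \<le> d (s k) (s l)" using ex by blast
  show "r \<le> (SUP (x, y)\<in>s ` {N..} \<times> s ` {N..}. d x y)"
    by (rule cSUP_upper2[where x = "(s k, s l)"]) (use kl bd in \<open>auto simp: bdd_above_def\<close>)
qed simp

lemma less_caD:
  assumes bd: "\<And>m n. d (s m) (s n) \<le> B" and nn: "\<And>m n. 0 \<le> d (s m) (s n)"
    and less: "r < ca d s"
  shows "\<exists>k\<ge>N. \<exists>l\<ge>N. r < d (s k) (s l)"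
proof -
  let ?S = "\<lambda>N. (SUP (x, y)\<in>s ` {N..} \<times> s ` {N..}. d x y)"
  have bdd: "bdd_above ((\<lambda>(x, y). d x y) ` (s ` {N..} \<times> s ` {N..}))" for N
    using bd by (auto simp: bdd_above_def)
  have "0 \<le> ?S N" for N
    by (rule cSUP_upper2[where x = "(s N, s N)"]) (use bdd nn in auto)
  then have "ca d s \<le> ?S N"
    unfolding ca_def by (intro cINF_lower bdd_belowI2) auto
  with less have "r < ?S N" by simp
  then show ?thesis
    using bdd by (subst (asm) less_cSUP_iff) (auto simp: Bex_def)
qed

lemma ca_le:
  assumes bd: "\<And>m n. d (s m) (s n) \<le> B" and nn: "\<And>m n. 0 \<le> d (s m) (s n)"
  shows "ca d s \<le> B"
proof (rule ccontr)
  assume "\<not> ca d s \<le> B"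
  then show False using less_caD[of d s B B 0] bd nn by (meson not_le)
qed

context normed_vector_space
begin

lemma dual_ball_dist_le:
  assumes "f \<in> dual_ball V" "\<And>n. s n \<in> carrier V" "\<And>n. nrm V (s n) \<le> B"
  shows "dist (f (s m)) (f (s n)) \<le> 2 * B"
proof -
  have "dist (f (s m)) (f (s n)) \<le> norm (f (s m)) + norm (f (s n))"
    by (simp add: dist_norm norm_triangle_ineq4)
  also have "\<dots> \<le> nrm V (s m) + nrm V (s n)"
    using assms by (intro add_mono dual_ball_le) auto
  also have "\<dots> \<le> 2 * B" using assms(3)[of m] assms(3)[of n] by simp
  finally show ?thesis .
qed

lemma bdd_above_delta:
  assumes s: "\<And>n. s n \<in> carrier V" "\<And>n. nrm V (s n) \<le> B"
  shows "bdd_above ((\<lambda>f. ca dist (\<lambda>n. f (s n))) ` dual_ball V)"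
  by (rule bdd_aboveI2[where M = "2 * B"], rule ca_le)
     (use dual_ball_dist_le[OF _ s] in auto)

lemma ndist_le:
  assumes "\<And>n. s n \<in> carrier V" "\<And>n. nrm V (s n) \<le> B"
  shows "ndist V (s m) (s n) \<le> 2 * B"
  using nrm_diff_le[of "s m" "s n"] assms(1)[of m] assms(1)[of n] assms(2)[of m] assms(2)[of n]
  by (simp add: ndist_eq)

end


section \<open>A subsequence form of the Schur property\<close>

text \<open>
  A space has this property if every bounded sequence has a subsequence on which some functional
  of the dual ball takes values close to the norms divided by \<open>c\<close>. It strengthens
  \<open>limsup \<bar>f (u n)\<bar> \<ge> limsup \<parallel>u n\<parallel> / c - e\<close> in that the values are close to nonnegative reals, so
  that such functionals on different summands can be added.
\<close>

definition aligned_norming :: "real \<Rightarrow> ('k::real_normed_field, 'a) normed_module \<Rightarrow> bool" where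
  "aligned_norming c V \<longleftrightarrow>
     (\<forall>u e. bounded_seq V u \<longrightarrow> e > 0 \<longrightarrow>
        (\<exists>f\<in>dual_ball V. \<exists>s :: nat \<Rightarrow> nat. strict_mono s \<and>
           (\<forall>n. norm (f (u (s n)) - of_real (nrm V (u (s n)) / c)) \<le> e)))"

lemma frequently_subseq:
  assumes "\<And>N::nat. \<exists>n\<ge>N. P n"
  obtains s :: "nat \<Rightarrow> nat" where "strict_mono s" "\<And>n. P (s n)"
proof -
  have "infinite {n. P n}"
    using assms by (auto simp: infinite_nat_iff_unbounded_le)
  then show ?thesis
    using that infinite_enumerate[of "{n. P n}"] by auto
qed

lemma bounded_convergent_subseq:
  fixes F :: "nat \<Rightarrow> 'b::heine_borel"
  assumes "bounded (range F)"
  obtains l s where "strict_mono s" "(\<lambda>n. F (s n)) \<longlonglongrightarrow> l"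
  using bounded_imp_convergent_subsequence[OF assms] by (auto simp: o_def)

text \<open>
  The conclusion bounds \<open>\<bar>f (v n)\<bar>\<close> itself, whereas the Schur property only speaks of oscillations;
  no factor is lost in the passage.
\<close>

lemma Schur_imp_frequently_large:
  fixes V :: "('k::real_normed_field, 'a) normed_module"
  assumes V: "Schur_property c V" and c: "c > 0"
    and v: "bounded_seq V v" and lim: "(\<lambda>n. nrm V (v n)) \<longlonglongrightarrow> \<alpha>" and e: "e > 0"
  shows "\<exists>f\<in>dual_ball V. \<forall>N. \<exists>n\<ge>N. \<alpha> / c - e < norm (f (v n))"
proof -
  interpret banach_space V using V by (simp add: Schur_property_def)
  obtain B where "B > 0" and B: "\<And>n. v n \<in> carrier V" "\<And>n. nrm V (v n) \<le> B"
    by (rule bounded_seqE[OF v]) blast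
  \<comment> \<open>The values of a functional on \<open>t\<close> are symmetric about 0, so their spread controls their size.\<close>
  define t where "t = (\<lambda>n. if even n then v (n div 2) else \<ominus>\<^bsub>V\<^esub> v (n div 2))"
  have t: "\<And>n. t n \<in> carrier V" "\<And>n. nrm V (t n) \<le> B"
    using B by (auto simp: t_def nrm_minus)
  have nrm_dbl: "nrm V (x \<ominus>\<^bsub>V\<^esub> (\<ominus>\<^bsub>V\<^esub> x)) = 2 * nrm V x" if x: "x \<in> carrier V" for x
  proof -
    have "x \<ominus>\<^bsub>V\<^esub> (\<ominus>\<^bsub>V\<^esub> x) = 2 \<odot>\<^bsub>V\<^esub> x"
      using x smult_l_distr[of 1 1 x] by (simp add: a_minus_def scale_one_left)
    then show ?thesis using x by (simp add: nrm_smult)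
  qed
  have "r \<le> ca (ndist V) t" if r: "r < 2 * \<alpha>" for r
  proof (rule ca_ge)
    fix N
    have "\<forall>\<^sub>F n in sequentially. r / 2 < nrm V (v n)"
      using lim r by (intro order_tendstoD) auto
    then obtain M where M: "\<And>n. n \<ge> M \<Longrightarrow> r / 2 < nrm V (v n)"
      by (auto simp: eventually_sequentially)
    define n where "n = max M N"
    have "ndist V (t (2 * n)) (t (2 * n + 1)) = 2 * nrm V (v n)"
      using B nrm_dbl by (simp add: t_def ndist_eq)
    also have "\<dots> > r" using M[of n] by (simp add: n_def)
    finally show "\<exists>k\<ge>N. \<exists>l\<ge>N. r \<le> ndist V (t k) (t l)"
      by (intro exI[of _ "2 * n"] exI[of _ "2 * n + 1"] conjI) (auto simp: n_def)
  qed (rule ndist_le[where s = t, OF t])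
  then have "2 * \<alpha> \<le> ca (ndist V) t" by (rule dense_le)
  also have "\<dots> \<le> c * delta V t"
    using V bounded_seqI[OF t] by (simp add: Schur_property_def)
  finally have "2 * \<alpha> / c \<le> delta V t" using c by (simp add: divide_le_eq mult.commute)
  then have "2 * \<alpha> / c - 2 * e < delta V t" using e by linarith
  then obtain f where f: "f \<in> dual_ball V" "2 * \<alpha> / c - 2 * e < ca dist (\<lambda>n. f (t n))"
    unfolding delta_def using bdd_above_delta[OF t] zero_in_dual_ball
    by (subst (asm) less_cSUP_iff) auto
  have "\<exists>n\<ge>N. \<alpha> / c - e < norm (f (v n))" for N
  proof -
    obtain k l where kl: "k \<ge> 2 * N" "l \<ge> 2 * N" "2 * \<alpha> / c - 2 * e < dist (f (t k)) (f (t l))"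
      using less_caD[OF dual_ball_dist_le[where s = t, OF f(1) t] zero_le_dist f(2), of "2 * N"] by blast
    have half: "norm (f (t m)) = norm (f (v (m div 2)))" for m
      using B dual_ball_minus[OF f(1)] by (simp add: t_def)
    have "dist (f (t k)) (f (t l)) \<le> norm (f (v (k div 2))) + norm (f (v (l div 2)))"
      by (metis dist_norm half norm_triangle_ineq4)
    with kl have "\<alpha> / c - e < norm (f (v (k div 2))) \<or> \<alpha> / c - e < norm (f (v (l div 2)))"
      by argo
    moreover have "k div 2 \<ge> N" "l div 2 \<ge> N" using kl by auto
    ultimately show ?thesis by blast
  qed
  with f(1) show ?thesis by blast
qed

lemma Schur_imp_aligned_norming:
  fixes V :: "('k::{real_normed_field, heine_borel}, 'a) normed_module"
  assumes V: "Schur_property c V" and c: "c > 0"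
  shows "aligned_norming c V"
  unfolding aligned_norming_def
proof (intro allI impI)
  fix u and e :: real assume u: "bounded_seq V u" and e: "e > 0"
  interpret banach_space V using V by (simp add: Schur_property_def)
  obtain B where "B > 0" and B: "\<And>n. u n \<in> carrier V" "\<And>n. nrm V (u n) \<le> B"
    by (rule bounded_seqE[OF u]) blast
  have "bounded (range (\<lambda>n. nrm V (u n)))"
    using B nrm_nonneg by (intro boundedI[where B = B]) auto
  then obtain \<alpha> s1 where s1: "strict_mono s1" and lim1: "(\<lambda>n. nrm V (u (s1 n))) \<longlonglongrightarrow> \<alpha>"
    by (rule bounded_convergent_subseq)
  define v where "v = (\<lambda>n. u (s1 n))"
  have vB: "\<And>n. v n \<in> carrier V" "\<And>n. nrm V (v n) \<le> B" using B by (auto simp: v_def)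
  have lim: "(\<lambda>n. nrm V (v n)) \<longlonglongrightarrow> \<alpha>" using lim1 by (simp add: v_def)
  \<comment> \<open>The limit of the aligned values; it is 0 when \<open>\<alpha> / c\<close> is so small that the zero functional serves.\<close>
  define \<rho> where "\<rho> = max 0 (\<alpha> / c - e / 2)"
  have \<alpha>: "\<alpha> \<ge> 0" using lim vB nrm_nonneg by (intro LIMSEQ_le_const[OF lim]) auto
  have "\<bar>max 0 (a - e / 2) - a\<bar> < e" if "a \<ge> 0" for a
    using e that by (auto simp: max_def)
  then have \<rho>: "\<bar>\<rho> - \<alpha> / c\<bar> < e" using c \<alpha> by (simp add: \<rho>_def)
  have "\<exists>g\<in>dual_ball V. \<exists>s. strict_mono s \<and> (\<lambda>n. g (v (s n))) \<longlonglongrightarrow> of_real \<rho>"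
  proof (cases "\<rho> = 0")
    case True
    then show ?thesis using zero_in_dual_ball by (auto intro!: bexI[of _ "\<lambda>x. 0"] exI[of _ id] strict_mono_id)
  next
    case False
    then have \<rho>_pos: "\<rho> > 0" "\<rho> = \<alpha> / c - e / 2" unfolding \<rho>_def by linarith+
    have "\<exists>f\<in>dual_ball V. \<forall>N. \<exists>n\<ge>N. \<alpha> / c - e / 2 < norm (f (v n))"
      using e by (intro Schur_imp_frequently_large[OF V c bounded_seqI[where s = v, OF vB] lim]) simp
    then obtain f where f: "f \<in> dual_ball V" and inf: "\<And>N. \<exists>n\<ge>N. \<rho> < norm (f (v n))"
      unfolding \<rho>_pos(2) by blast
    obtain s2 :: "nat \<Rightarrow> nat" where s2: "strict_mono s2" "\<And>n. \<rho> < norm (f (v (s2 n)))"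
      using frequently_subseq[OF inf] by blast
    have "norm (f (v n)) \<le> B" for n
      using dual_ball_le[OF f vB(1)[of n]] vB(2)[of n] by simp
    then have "bounded (range (\<lambda>n. f (v (s2 n))))"
      by (intro boundedI[where B = B]) auto
    then obtain z s3 where s3: "strict_mono s3" and z: "(\<lambda>n. f (v (s2 (s3 n)))) \<longlonglongrightarrow> z"
      by (rule bounded_convergent_subseq)
    have z_ge: "\<rho> \<le> norm z"
      using s2(2) by (intro LIMSEQ_le_const[OF tendsto_norm[OF z]]) (auto intro: less_imp_le)
    then have "z \<noteq> 0" using \<rho>_pos by auto
    \<comment> \<open>Rotate and shrink \<open>f\<close> so that the limit \<open>z\<close> becomes the nonnegative real \<open>\<rho> \<le> \<bar>z\<bar>\<close>.\<close>
    define g where "g = (\<lambda>x. of_real \<rho> / z * f x)"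
    have "g \<in> dual_ball V"
      unfolding g_def using f z_ge \<rho>_pos(1) \<open>z \<noteq> 0\<close>
      by (intro scale_in_dual_ball) (auto simp: norm_divide)
    moreover have "(\<lambda>n. g (v (s2 (s3 n)))) \<longlonglongrightarrow> of_real \<rho> / z * z"
      unfolding g_def by (intro tendsto_mult tendsto_const z)
    ultimately show ?thesis
      using \<open>z \<noteq> 0\<close> strict_mono_o[OF s2(1) s3]
      by (auto intro!: bexI[of _ g] exI[of _ "s2 \<circ> s3"])
  qed
  then obtain g and s :: "nat \<Rightarrow> nat" where g: "g \<in> dual_ball V" and s: "strict_mono s"
    and gl: "(\<lambda>n. g (v (s n))) \<longlonglongrightarrow> of_real \<rho>" by blast
  have "(\<lambda>n. nrm V (v (s n))) \<longlonglongrightarrow> \<alpha>"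
    using LIMSEQ_subseq_LIMSEQ[OF lim s] by (simp add: o_def)
  then have "(\<lambda>n. norm (g (v (s n)) - of_real (nrm V (v (s n)) / c)))
      \<longlonglongrightarrow> norm (of_real \<rho> - of_real (\<alpha> / c) :: 'k)"
    using c by (intro tendsto_intros gl) auto
  also have "norm (of_real \<rho> - of_real (\<alpha> / c) :: 'k) = \<bar>\<rho> - \<alpha> / c\<bar>"
    by (metis norm_of_real of_real_diff)
  finally have "\<forall>\<^sub>F n in sequentially. norm (g (v (s n)) - of_real (nrm V (v (s n)) / c)) < e"
    using \<rho> by (rule order_tendstoD)
  then obtain N where N: "\<And>n. n \<ge> N \<Longrightarrow> norm (g (v (s n)) - of_real (nrm V (v (s n)) / c)) < e"
    by (auto simp: eventually_sequentially)
  have "strict_mono (\<lambda>n. s1 (s (n + N)))"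
    using s s1 by (auto simp: strict_mono_def)
  moreover have "norm (g (u (s1 (s (n + N)))) - of_real (nrm V (u (s1 (s (n + N)))) / c)) \<le> e" for n
    using N[of "n + N"] by (simp add: v_def)
  ultimately show "\<exists>f\<in>dual_ball V. \<exists>s :: nat \<Rightarrow> nat. strict_mono s \<and>
           (\<forall>n. norm (f (u (s n)) - of_real (nrm V (u (s n)) / c)) \<le> e)"
    using g by (intro bexI[of _ g] exI[of _ "\<lambda>n. s1 (s (n + N))"]) auto
qed

lemma aligned_norming_imp_Schur:
  fixes V :: "('k::real_normed_field, 'a) normed_module"
  assumes banach: "banach_space V" and al: "aligned_norming c V" and c: "c > 0"
  shows "Schur_property c V"
  unfolding Schur_property_def
proof (intro conjI allI impI banach)
  fix x assume x: "bounded_seq V x"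
  interpret banach_space V by (rule banach)
  obtain B where B: "B > 0" "\<And>n. x n \<in> carrier V" "\<And>n. nrm V (x n) \<le> B"
    by (rule bounded_seqE[OF x]) blast
  have "r / c \<le> delta V x" if r: "r < ca (ndist V) x" for r
  proof (rule field_le_epsilon)
    fix e :: real assume e: "e > 0"
    have "\<forall>N. \<exists>p. fst p \<ge> N \<and> snd p \<ge> N \<and> r < nrm V (x (fst p) \<ominus>\<^bsub>V\<^esub> x (snd p))"
    proof
      fix N
      obtain k l where "k \<ge> N" "l \<ge> N" "r < ndist V (x k) (x l)"
        using less_caD[OF ndist_le[where s = x, OF B(2,3)] Metric_space.nonneg[OF Metric_space_ndist] r]
        by blast
      then show "\<exists>p. fst p \<ge> N \<and> snd p \<ge> N \<and> r < nrm V (x (fst p) \<ominus>\<^bsub>V\<^esub> x (snd p))"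
        using B by (intro exI[of _ "(k, l)"]) (simp add: ndist_eq)
    qed
    then obtain p where p: "\<And>N. fst (p N) \<ge> N" "\<And>N. snd (p N) \<ge> N"
        "\<And>N. r < nrm V (x (fst (p N)) \<ominus>\<^bsub>V\<^esub> x (snd (p N)))"
      by metis
    define u where "u N = x (fst (p N)) \<ominus>\<^bsub>V\<^esub> x (snd (p N))" for N
    have u: "u N \<in> carrier V" "nrm V (u N) \<le> 2 * B" "r < nrm V (u N)" for N
      using B ndist_le[where s = x, OF B(2,3), of "fst (p N)" "snd (p N)"] p(3) by (auto simp: u_def ndist_eq)
    have "bounded_seq V u" using u(1,2) by (rule bounded_seqI)
    then obtain f and s :: "nat \<Rightarrow> nat" where f: "f \<in> dual_ball V" and s: "strict_mono s"
      and al: "\<And>n. norm (f (u (s n)) - of_real (nrm V (u (s n)) / c)) \<le> e"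
      using al e unfolding aligned_norming_def by blast
    have "r / c - e \<le> ca dist (\<lambda>n. f (x n))"
    proof (rule ca_ge)
      fix N
      have "r / c - e \<le> nrm V (u (s N)) / c - e"
        using u(3)[of "s N"] c by (simp add: divide_right_mono less_imp_le)
      also have "\<dots> \<le> norm (of_real (nrm V (u (s N)) / c) :: 'k) - norm (f (u (s N)) - of_real (nrm V (u (s N)) / c))"
        unfolding norm_of_real using al[of N] by linarith
      also have "\<dots> \<le> norm (f (u (s N)))"
        by (metis norm_minus_commute norm_triangle_ineq2 diff_le_eq add.commute)
      also have "\<dots> = dist (f (x (fst (p (s N))))) (f (x (snd (p (s N)))))"
        using B f by (simp add: u_def dual_ball_diff dist_norm)
      finally show "\<exists>k\<ge>N. \<exists>l\<ge>N. r / c - e \<le> dist (f (x k)) (f (x l))"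
        using p(1)[of "s N"] p(2)[of "s N"] seq_suble[OF s, of N] by (meson order_trans)
    qed (rule dual_ball_dist_le[where s = x, OF f B(2,3)])
    also have "\<dots> \<le> delta V x"
      unfolding delta_def using bdd_above_delta[OF B(2,3)] f by (rule cSUP_upper2[OF _ _ order_refl])
    finally show "r / c \<le> delta V x + e" by simp
  qed
  then have "r \<le> c * delta V x" if "r < ca (ndist V) x" for r
    using that c by (simp add: divide_le_eq mult.commute)
  then show "ca (ndist V) x \<le> c * delta V x" by (rule dense_le)
qed

section \<open>The l1-sum as a Banach space\<close>

lemma summable_on_nonneg_comparison:
  fixes f g :: "'i \<Rightarrow> real"
  assumes "g summable_on A" "\<And>i. i \<in> A \<Longrightarrow> 0 \<le> f i" "\<And>i. i \<in> A \<Longrightarrow> f i \<le> g i"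
  shows "f summable_on A"
proof -
  have "(\<lambda>i. norm (f i)) summable_on A"
    by (rule Infinite_Sum.abs_summable_on_comparison_test'[OF assms(1)]) (use assms(2,3) in auto)
  then show ?thesis using assms(2) by (simp cong: summable_on_cong)
qed

lemma l1_sum_simps:
  "x \<in> carrier (l1_sum I V) \<longleftrightarrow> (\<forall>i\<in>I. x i \<in> carrier (V i)) \<and> x \<in> extensional I \<and>
     (\<lambda>i. nrm (V i) (x i)) summable_on I"
  "\<zero>\<^bsub>l1_sum I V\<^esub> = (\<lambda>i\<in>I. \<zero>\<^bsub>V i\<^esub>)"
  "x \<oplus>\<^bsub>l1_sum I V\<^esub> y = (\<lambda>i\<in>I. x i \<oplus>\<^bsub>V i\<^esub> y i)"
  "a \<odot>\<^bsub>l1_sum I V\<^esub> x = (\<lambda>i\<in>I. a \<odot>\<^bsub>V i\<^esub> x i)"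
  "nrm (l1_sum I V) x = (\<Sum>\<^sub>\<infinity>i\<in>I. nrm (V i) (x i))"
  by (auto simp: l1_sum_def PiE_def)

text \<open>A family of normed spaces, not necessarily complete, over a common scalar field.\<close>

locale normed_family =
  fixes I :: "'i set" and V :: "'i \<Rightarrow> ('k::real_normed_field, 'a) normed_module"
  assumes normed: "i \<in> I \<Longrightarrow> normed_vector_space (V i)"
begin

lemma summable_add:
  assumes "x \<in> carrier (l1_sum I V)" "y \<in> carrier (l1_sum I V)"
  shows "(\<lambda>i. nrm (V i) (x i \<oplus>\<^bsub>V i\<^esub> y i)) summable_on I"
proof (rule summable_on_nonneg_comparison)
  show "(\<lambda>i. nrm (V i) (x i) + nrm (V i) (y i)) summable_on I"
    using assms by (intro summable_on_add) (auto simp: l1_sum_simps)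
next
  fix i assume i: "i \<in> I"
  interpret normed_vector_space "V i" by (rule normed[OF i])
  show "0 \<le> nrm (V i) (x i \<oplus>\<^bsub>V i\<^esub> y i)"
    using assms i by (intro nrm_nonneg) (auto simp: l1_sum_simps)
  show "nrm (V i) (x i \<oplus>\<^bsub>V i\<^esub> y i) \<le> nrm (V i) (x i) + nrm (V i) (y i)"
    using assms i by (intro nrm_triangle) (auto simp: l1_sum_simps)
qed

lemma l1_sum_add_closed:
  assumes x: "x \<in> carrier (l1_sum I V)" and y: "y \<in> carrier (l1_sum I V)"
  shows "x \<oplus>\<^bsub>l1_sum I V\<^esub> y \<in> carrier (l1_sum I V)"
proof -
  have "x i \<oplus>\<^bsub>V i\<^esub> y i \<in> carrier (V i)" if i: "i \<in> I" for i
  proof -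
    interpret normed_vector_space "V i" by (rule normed[OF i])
    show ?thesis using x y i by (simp add: l1_sum_simps)
  qed
  then show ?thesis
    using summable_add[OF x y] by (simp add: l1_sum_simps cong: summable_on_cong)
qed

lemma l1_sum_smult_nrm:
  assumes "x \<in> carrier (l1_sum I V)" "i \<in> I"
  shows "nrm (V i) (a \<odot>\<^bsub>V i\<^esub> x i) = norm a * nrm (V i) (x i)"
  using assms normed_vector_space.nrm_smult[OF normed] by (auto simp: l1_sum_simps)

lemma l1_sum_smult_closed:
  assumes x: "x \<in> carrier (l1_sum I V)"
  shows "a \<odot>\<^bsub>l1_sum I V\<^esub> x \<in> carrier (l1_sum I V)"
proof -
  have "a \<odot>\<^bsub>V i\<^esub> x i \<in> carrier (V i)" if "i \<in> I" for i
    using normed_vector_space.scale_closed[OF normed[OF that]] x that by (simp add: l1_sum_simps)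
  moreover have "(\<lambda>i. norm a * nrm (V i) (x i)) summable_on I"
    using x by (intro summable_on_cmult_right) (simp add: l1_sum_simps)
  ultimately show ?thesis
    using l1_sum_smult_nrm[OF x] by (simp add: l1_sum_simps cong: summable_on_cong)
qed

lemma l1_sum_zero_closed: "\<zero>\<^bsub>l1_sum I V\<^esub> \<in> carrier (l1_sum I V)"
proof -
  have "\<zero>\<^bsub>V i\<^esub> \<in> carrier (V i) \<and> nrm (V i) \<zero>\<^bsub>V i\<^esub> = 0" if "i \<in> I" for i
  proof -
    interpret normed_vector_space "V i" by (rule normed[OF that])
    show ?thesis by simp
  qed
  then show ?thesis by (simp add: l1_sum_simps cong: summable_on_cong)
qed

lemma l1_sum_ext:
  assumes "x \<in> carrier (l1_sum I V)" "y \<in> carrier (l1_sum I V)" "\<And>i. i \<in> I \<Longrightarrow> x i = y i"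
  shows "x = y"
  using assms by (auto simp: l1_sum_simps intro: extensionalityI)

lemma abelian_group_l1_sum: "abelian_group (l1_sum I V)"
proof (rule abelian_groupI)
  fix x assume x: "x \<in> carrier (l1_sum I V)"
  show "\<zero>\<^bsub>l1_sum I V\<^esub> \<oplus>\<^bsub>l1_sum I V\<^esub> x = x"
  proof (rule l1_sum_ext)
    fix i assume i: "i \<in> I"
    interpret normed_vector_space "V i" by (rule normed[OF i])
    show "(\<zero>\<^bsub>l1_sum I V\<^esub> \<oplus>\<^bsub>l1_sum I V\<^esub> x) i = x i"
      using x i by (simp add: l1_sum_simps)
  qed (simp_all add: x l1_sum_add_closed l1_sum_zero_closed)
  show "\<exists>y\<in>carrier (l1_sum I V). y \<oplus>\<^bsub>l1_sum I V\<^esub> x = \<zero>\<^bsub>l1_sum I V\<^esub>"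
  proof (rule bexI[of _ "(-1) \<odot>\<^bsub>l1_sum I V\<^esub> x"])
    show "((-1) \<odot>\<^bsub>l1_sum I V\<^esub> x) \<oplus>\<^bsub>l1_sum I V\<^esub> x = \<zero>\<^bsub>l1_sum I V\<^esub>"
    proof (rule l1_sum_ext)
      fix i assume i: "i \<in> I"
      interpret normed_vector_space "V i" by (rule normed[OF i])
      show "((-1) \<odot>\<^bsub>l1_sum I V\<^esub> x \<oplus>\<^bsub>l1_sum I V\<^esub> x) i = \<zero>\<^bsub>l1_sum I V\<^esub> i"
        using x i by (simp add: l1_sum_simps scale_minus_one M.l_neg)
    qed (simp_all add: x l1_sum_add_closed l1_sum_smult_closed l1_sum_zero_closed)
  qed (simp add: x l1_sum_smult_closed)
next
  fix x y assume xy: "x \<in> carrier (l1_sum I V)" "y \<in> carrier (l1_sum I V)"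
  show "x \<oplus>\<^bsub>l1_sum I V\<^esub> y = y \<oplus>\<^bsub>l1_sum I V\<^esub> x"
  proof (rule l1_sum_ext)
    fix i assume i: "i \<in> I"
    interpret normed_vector_space "V i" by (rule normed[OF i])
    show "(x \<oplus>\<^bsub>l1_sum I V\<^esub> y) i = (y \<oplus>\<^bsub>l1_sum I V\<^esub> x) i"
      using xy i by (simp add: l1_sum_simps M.a_comm)
  qed (simp_all add: xy l1_sum_add_closed)
next
  fix x y z
  assume xyz: "x \<in> carrier (l1_sum I V)" "y \<in> carrier (l1_sum I V)" "z \<in> carrier (l1_sum I V)"
  show "(x \<oplus>\<^bsub>l1_sum I V\<^esub> y) \<oplus>\<^bsub>l1_sum I V\<^esub> z = x \<oplus>\<^bsub>l1_sum I V\<^esub> (y \<oplus>\<^bsub>l1_sum I V\<^esub> z)"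
  proof (rule l1_sum_ext)
    fix i assume i: "i \<in> I"
    interpret normed_vector_space "V i" by (rule normed[OF i])
    show "((x \<oplus>\<^bsub>l1_sum I V\<^esub> y) \<oplus>\<^bsub>l1_sum I V\<^esub> z) i = (x \<oplus>\<^bsub>l1_sum I V\<^esub> (y \<oplus>\<^bsub>l1_sum I V\<^esub> z)) i"
      using xyz i by (simp add: l1_sum_simps M.a_assoc)
  qed (simp_all add: xyz l1_sum_add_closed)
qed (simp_all add: l1_sum_add_closed l1_sum_zero_closed)

lemma module_l1_sum: "Module.module (ring_of_type_algebra :: 'k ring) (l1_sum I V)"
proof (rule moduleI)
  show "cring (ring_of_type_algebra :: 'k ring)" by (rule cring_from_type_algebra)
  show "abelian_group (l1_sum I V)" by (rule abelian_group_l1_sum)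
next
  fix a b :: 'k and x assume x: "x \<in> carrier (l1_sum I V)"
  have "(a + b) \<odot>\<^bsub>l1_sum I V\<^esub> x = a \<odot>\<^bsub>l1_sum I V\<^esub> x \<oplus>\<^bsub>l1_sum I V\<^esub> b \<odot>\<^bsub>l1_sum I V\<^esub> x"
  proof (rule l1_sum_ext)
    fix i assume i: "i \<in> I"
    interpret normed_vector_space "V i" by (rule normed[OF i])
    show "((a + b) \<odot>\<^bsub>l1_sum I V\<^esub> x) i = (a \<odot>\<^bsub>l1_sum I V\<^esub> x \<oplus>\<^bsub>l1_sum I V\<^esub> b \<odot>\<^bsub>l1_sum I V\<^esub> x) i"
      using x i smult_l_distr[of a b "x i"] by (simp add: l1_sum_simps)
  qed (simp_all add: x l1_sum_add_closed l1_sum_smult_closed)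
  then show "(a \<oplus>\<^bsub>ring_of_type_algebra\<^esub> b) \<odot>\<^bsub>l1_sum I V\<^esub> x =
      a \<odot>\<^bsub>l1_sum I V\<^esub> x \<oplus>\<^bsub>l1_sum I V\<^esub> b \<odot>\<^bsub>l1_sum I V\<^esub> x" by simp
  have "(a * b) \<odot>\<^bsub>l1_sum I V\<^esub> x = a \<odot>\<^bsub>l1_sum I V\<^esub> (b \<odot>\<^bsub>l1_sum I V\<^esub> x)"
  proof (rule l1_sum_ext)
    fix i assume i: "i \<in> I"
    interpret normed_vector_space "V i" by (rule normed[OF i])
    show "((a * b) \<odot>\<^bsub>l1_sum I V\<^esub> x) i = (a \<odot>\<^bsub>l1_sum I V\<^esub> (b \<odot>\<^bsub>l1_sum I V\<^esub> x)) i"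
      using x i smult_assoc1[of a b "x i"] by (simp add: l1_sum_simps)
  qed (simp_all add: x l1_sum_smult_closed)
  then show "(a \<otimes>\<^bsub>ring_of_type_algebra\<^esub> b) \<odot>\<^bsub>l1_sum I V\<^esub> x =
      a \<odot>\<^bsub>l1_sum I V\<^esub> (b \<odot>\<^bsub>l1_sum I V\<^esub> x)" by simp
next
  fix a :: 'k and x y assume xy: "x \<in> carrier (l1_sum I V)" "y \<in> carrier (l1_sum I V)"
  show "a \<odot>\<^bsub>l1_sum I V\<^esub> (x \<oplus>\<^bsub>l1_sum I V\<^esub> y) = a \<odot>\<^bsub>l1_sum I V\<^esub> x \<oplus>\<^bsub>l1_sum I V\<^esub> a \<odot>\<^bsub>l1_sum I V\<^esub> y"
  proof (rule l1_sum_ext)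
    fix i assume i: "i \<in> I"
    interpret normed_vector_space "V i" by (rule normed[OF i])
    show "(a \<odot>\<^bsub>l1_sum I V\<^esub> (x \<oplus>\<^bsub>l1_sum I V\<^esub> y)) i =
        (a \<odot>\<^bsub>l1_sum I V\<^esub> x \<oplus>\<^bsub>l1_sum I V\<^esub> a \<odot>\<^bsub>l1_sum I V\<^esub> y) i"
      using xy i smult_r_distr[of a "x i" "y i"] by (simp add: l1_sum_simps)
  qed (simp_all add: xy l1_sum_add_closed l1_sum_smult_closed)
next
  fix x assume x: "x \<in> carrier (l1_sum I V)"
  have "1 \<odot>\<^bsub>l1_sum I V\<^esub> x = x"
  proof (rule l1_sum_ext)
    fix i assume i: "i \<in> I"
    show "(1 \<odot>\<^bsub>l1_sum I V\<^esub> x) i = x i"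
      using x i normed_vector_space.scale_one_left[OF normed[OF i]] by (simp add: l1_sum_simps)
  qed (simp_all add: x l1_sum_smult_closed)
  then show "\<one>\<^bsub>ring_of_type_algebra\<^esub> \<odot>\<^bsub>l1_sum I V\<^esub> x = x" by simp
qed (simp_all add: l1_sum_smult_closed)

lemma coordinate_nrm_nonneg:
  "x \<in> carrier (l1_sum I V) \<Longrightarrow> i \<in> I \<Longrightarrow> 0 \<le> nrm (V i) (x i)"
  using normed_vector_space.nrm_nonneg[OF normed] by (auto simp: l1_sum_simps)

lemma coordinate_nrm_le:
  assumes "x \<in> carrier (l1_sum I V)" "i \<in> I"
  shows "nrm (V i) (x i) \<le> nrm (l1_sum I V) x"
  using finite_sum_le_infsum[of "\<lambda>i. nrm (V i) (x i)" I "{i}"] assms coordinate_nrm_nonneg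
  by (simp add: l1_sum_simps)

lemma normed_vector_space_l1_sum: "normed_vector_space (l1_sum I V)"
proof -
  have "nrm (l1_sum I V) x = 0 \<longleftrightarrow> x = \<zero>\<^bsub>l1_sum I V\<^esub>" if x: "x \<in> carrier (l1_sum I V)" for x
  proof
    assume 0: "nrm (l1_sum I V) x = 0"
    show "x = \<zero>\<^bsub>l1_sum I V\<^esub>"
    proof (rule l1_sum_ext[OF x l1_sum_zero_closed])
      fix i assume i: "i \<in> I"
      then have "nrm (V i) (x i) = 0"
        using coordinate_nrm_le[OF x i] coordinate_nrm_nonneg[OF x i] 0 by simp
      then show "x i = \<zero>\<^bsub>l1_sum I V\<^esub> i"
        using normed_vector_space.nrm_eq_0_iff[OF normed[OF i]] x i by (simp add: l1_sum_simps)
    qed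
  next
    assume x0: "x = \<zero>\<^bsub>l1_sum I V\<^esub>"
    have "nrm (V i) (x i) = 0" if "i \<in> I" for i
      using normed_vector_space.nrm_zero[OF normed[OF that]] that by (simp add: x0 l1_sum_simps)
    then show "nrm (l1_sum I V) x = 0" by (simp add: l1_sum_simps cong: infsum_cong)
  qed
  moreover have "nrm (l1_sum I V) (x \<oplus>\<^bsub>l1_sum I V\<^esub> y) \<le> nrm (l1_sum I V) x + nrm (l1_sum I V) y"
    if xy: "x \<in> carrier (l1_sum I V)" "y \<in> carrier (l1_sum I V)" for x y
  proof -
    have "nrm (l1_sum I V) (x \<oplus>\<^bsub>l1_sum I V\<^esub> y) = (\<Sum>\<^sub>\<infinity>i\<in>I. nrm (V i) (x i \<oplus>\<^bsub>V i\<^esub> y i))"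
      by (simp add: l1_sum_simps cong: infsum_cong)
    also have "\<dots> \<le> (\<Sum>\<^sub>\<infinity>i\<in>I. nrm (V i) (x i) + nrm (V i) (y i))"
    proof (rule infsum_mono)
      show "(\<lambda>i. nrm (V i) (x i \<oplus>\<^bsub>V i\<^esub> y i)) summable_on I" using xy by (rule summable_add)
      show "(\<lambda>i. nrm (V i) (x i) + nrm (V i) (y i)) summable_on I"
        using xy by (intro summable_on_add) (auto simp: l1_sum_simps)
    qed (use xy normed_vector_space.nrm_triangle[OF normed] in \<open>auto simp: l1_sum_simps\<close>)
    also have "\<dots> = nrm (l1_sum I V) x + nrm (l1_sum I V) y"
      using xy by (simp add: l1_sum_simps infsum_add)
    finally show ?thesis .
  qed
  moreover have "nrm (l1_sum I V) (a \<odot>\<^bsub>l1_sum I V\<^esub> x) = norm a * nrm (l1_sum I V) x"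
    if x: "x \<in> carrier (l1_sum I V)" for a x
  proof -
    have "nrm (l1_sum I V) (a \<odot>\<^bsub>l1_sum I V\<^esub> x) = (\<Sum>\<^sub>\<infinity>i\<in>I. norm a * nrm (V i) (x i))"
      using l1_sum_smult_nrm[OF x] by (simp add: l1_sum_simps cong: infsum_cong)
    then show ?thesis by (simp add: infsum_cmult_right' l1_sum_simps)
  qed
  ultimately show ?thesis
    by (intro normed_vector_space.intro module_l1_sum normed_vector_space_axioms.intro) auto
qed

lemma l1_sum_diff:
  assumes "x \<in> carrier (l1_sum I V)" "y \<in> carrier (l1_sum I V)" "i \<in> I"
  shows "(x \<ominus>\<^bsub>l1_sum I V\<^esub> y) i = x i \<ominus>\<^bsub>V i\<^esub> y i"
proof -
  interpret L: normed_vector_space "l1_sum I V" by (rule normed_vector_space_l1_sum)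
  interpret Vi: normed_vector_space "V i" by (rule normed[OF assms(3)])
  have "(x \<ominus>\<^bsub>l1_sum I V\<^esub> y) i = (x \<oplus>\<^bsub>l1_sum I V\<^esub> (-1) \<odot>\<^bsub>l1_sum I V\<^esub> y) i"
    using assms by (simp add: a_minus_def L.scale_minus_one)
  also have "\<dots> = x i \<oplus>\<^bsub>V i\<^esub> (-1) \<odot>\<^bsub>V i\<^esub> y i"
    using assms by (simp add: l1_sum_simps)
  also have "\<dots> = x i \<ominus>\<^bsub>V i\<^esub> y i"
    using assms by (simp add: a_minus_def Vi.scale_minus_one l1_sum_simps)
  finally show ?thesis .
qed

lemma ndist_l1_sum:
  assumes "x \<in> carrier (l1_sum I V)" "y \<in> carrier (l1_sum I V)"
  shows "ndist (l1_sum I V) x y = (\<Sum>\<^sub>\<infinity>i\<in>I. ndist (V i) (x i) (y i))"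
    and "(\<lambda>i. ndist (V i) (x i) (y i)) summable_on I"
proof -
  interpret L: normed_vector_space "l1_sum I V" by (rule normed_vector_space_l1_sum)
  have *: "nrm (V i) ((x \<ominus>\<^bsub>l1_sum I V\<^esub> y) i) = ndist (V i) (x i) (y i)" if "i \<in> I" for i
    using assms that l1_sum_diff[OF assms that] by (simp add: ndist_def l1_sum_simps)
  show "ndist (l1_sum I V) x y = (\<Sum>\<^sub>\<infinity>i\<in>I. ndist (V i) (x i) (y i))"
    using assms * by (simp add: L.ndist_eq l1_sum_simps(5) cong: infsum_cong)
  have "x \<ominus>\<^bsub>l1_sum I V\<^esub> y \<in> carrier (l1_sum I V)" using assms by simp
  then show "(\<lambda>i. ndist (V i) (x i) (y i)) summable_on I"
    using * by (simp add: l1_sum_simps cong: summable_on_cong)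
qed

end

lemma banach_space_l1_sum:
  fixes V :: "'i \<Rightarrow> ('k::real_normed_field, 'a) normed_module"
  assumes banach: "\<And>i. i \<in> I \<Longrightarrow> banach_space (V i)"
  shows "banach_space (l1_sum I V)"
proof -
  interpret normed_family I V
    by (rule normed_family.intro) (rule banach_space.axioms(1)[OF banach])
  interpret L: normed_vector_space "l1_sum I V" by (rule normed_vector_space_l1_sum)
  interpret LM: Metric_space "carrier (l1_sum I V)" "ndist (l1_sum I V)" by (rule L.Metric_space_ndist)
  have MV: "Metric_space (carrier (V i)) (ndist (V i))" if "i \<in> I" for i
    by (rule normed_vector_space.Metric_space_ndist[OF normed[OF that]])
  have "LM.mcomplete"
    unfolding LM.mcomplete_def
  proof (intro allI impI)
    fix \<sigma> assume C: "LM.MCauchy \<sigma>"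
    have \<sigma>: "\<sigma> n \<in> carrier (l1_sum I V)" for n using C by (auto simp: LM.MCauchy_def)
    have \<sigma>i: "\<sigma> n i \<in> carrier (V i)" if "i \<in> I" for n i using \<sigma>[of n] that by (simp add: l1_sum_simps)
    have finite_le: "(\<Sum>i\<in>F. ndist (V i) (\<sigma> m i) (\<sigma> n i)) \<le> ndist (l1_sum I V) (\<sigma> m) (\<sigma> n)"
      if "finite F" "F \<subseteq> I" for F m n
      unfolding ndist_l1_sum(1)[OF \<sigma> \<sigma>]
      using ndist_l1_sum(2)[OF \<sigma> \<sigma>] that Metric_space.nonneg[OF MV] by (intro finite_sum_le_infsum) auto
    have "\<exists>l. l \<in> carrier (V i) \<and> (\<lambda>n. ndist (V i) (\<sigma> n i) l) \<longlonglongrightarrow> 0" if i: "i \<in> I" for i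
    proof -
      interpret Mi: Metric_space "carrier (V i)" "ndist (V i)" by (rule MV[OF i])
      have "Mi.MCauchy (\<lambda>n. \<sigma> n i)"
        unfolding Mi.MCauchy_def
      proof (intro conjI allI impI)
        fix e :: real assume "e > 0"
        then obtain N where N: "\<And>n m. N \<le> n \<Longrightarrow> N \<le> m \<Longrightarrow> ndist (l1_sum I V) (\<sigma> n) (\<sigma> m) < e"
          using C unfolding LM.MCauchy_def by blast
        show "\<exists>N. \<forall>n n'. N \<le> n \<longrightarrow> N \<le> n' \<longrightarrow> ndist (V i) (\<sigma> n i) (\<sigma> n' i) < e"
        proof (intro exI[of _ N] allI impI)
          fix n n' assume "N \<le> n" "N \<le> n'"
          then show "ndist (V i) (\<sigma> n i) (\<sigma> n' i) < e"
            using finite_le[of "{i}" n n'] N[of n n'] i by simp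
        qed
      qed (use \<sigma>i i in auto)
      moreover have "Mi.mcomplete" using banach[OF i] by (simp add: banach_space_def banach_space_axioms_def)
      ultimately obtain l where "limitin Mi.mtopology (\<lambda>n. \<sigma> n i) l sequentially"
        by (auto simp: Mi.mcomplete_def)
      then show ?thesis by (auto simp: Mi.limitin_metric_dist_null)
    qed
    then obtain y0 where y0: "\<And>i. i \<in> I \<Longrightarrow> y0 i \<in> carrier (V i)"
        "\<And>i. i \<in> I \<Longrightarrow> (\<lambda>n. ndist (V i) (\<sigma> n i) (y0 i)) \<longlonglongrightarrow> 0"
      by metis
    define y where "y = restrict y0 I"
    have y: "y i \<in> carrier (V i)" "(\<lambda>n. ndist (V i) (\<sigma> n i) (y i)) \<longlonglongrightarrow> 0" if "i \<in> I" for i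
      using y0 that by (auto simp: y_def)
    have ev_le: "\<exists>N. \<forall>n\<ge>N. \<forall>F. finite F \<longrightarrow> F \<subseteq> I \<longrightarrow> (\<Sum>i\<in>F. ndist (V i) (\<sigma> n i) (y i)) \<le> e"
      if e: "e > 0" for e
    proof -
      obtain N where N: "\<And>n m. N \<le> n \<Longrightarrow> N \<le> m \<Longrightarrow> ndist (l1_sum I V) (\<sigma> n) (\<sigma> m) < e"
        using C e unfolding LM.MCauchy_def by blast
      have "(\<Sum>i\<in>F. ndist (V i) (\<sigma> n i) (y i)) \<le> e" if n: "n \<ge> N" and F: "finite F" "F \<subseteq> I" for n F
      \<comment> \<open>Compare with \<open>\<sigma> m\<close> for large \<open>m\<close>: the error on the finite set \<open>F\<close> tends to 0.\<close>
      proof (rule LIMSEQ_le_const)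
        show "(\<lambda>m. e + (\<Sum>i\<in>F. ndist (V i) (\<sigma> m i) (y i))) \<longlonglongrightarrow> e"
          using tendsto_add[OF tendsto_const tendsto_sum[of F "\<lambda>i m. ndist (V i) (\<sigma> m i) (y i)" "\<lambda>i. 0"]] y(2) F
          by fastforce
        have "(\<Sum>i\<in>F. ndist (V i) (\<sigma> n i) (y i)) \<le> e + (\<Sum>i\<in>F. ndist (V i) (\<sigma> m i) (y i))" if m: "m \<ge> N" for m
        proof -
          have "(\<Sum>i\<in>F. ndist (V i) (\<sigma> n i) (y i))
              \<le> (\<Sum>i\<in>F. ndist (V i) (\<sigma> n i) (\<sigma> m i) + ndist (V i) (\<sigma> m i) (y i))"
            using F y(1) \<sigma>i by (intro sum_mono Metric_space.triangle[OF MV]) auto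
          also have "\<dots> \<le> e + (\<Sum>i\<in>F. ndist (V i) (\<sigma> m i) (y i))"
            using finite_le[OF F, of n m] N[OF n m] by (simp add: sum.distrib)
          finally show ?thesis .
        qed
        then show "\<exists>N. \<forall>m\<ge>N. (\<Sum>i\<in>F. ndist (V i) (\<sigma> n i) (y i)) \<le> e + (\<Sum>i\<in>F. ndist (V i) (\<sigma> m i) (y i))"
          by blast
      qed
      then show ?thesis by blast
    qed
    obtain N where N: "\<And>F. finite F \<Longrightarrow> F \<subseteq> I \<Longrightarrow> (\<Sum>i\<in>F. ndist (V i) (\<sigma> N i) (y i)) \<le> 1"
      using ev_le[of 1] by auto
    have summ: "(\<lambda>i. ndist (V i) (\<sigma> N i) (y i)) summable_on I"
      using N Metric_space.nonneg[OF MV] by (intro nonneg_bdd_above_summable_on) (auto simp: bdd_above_def)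
    have "(\<lambda>i. nrm (V i) (y i)) summable_on I"
    proof (rule summable_on_nonneg_comparison)
      show "(\<lambda>i. nrm (V i) (\<sigma> N i) + ndist (V i) (\<sigma> N i) (y i)) summable_on I"
        using \<sigma>[of N] summ by (intro summable_on_add) (auto simp: l1_sum_simps)
    next
      fix i assume i: "i \<in> I"
      interpret normed_vector_space "V i" by (rule normed[OF i])
      show "0 \<le> nrm (V i) (y i)" by (rule nrm_nonneg[OF y(1)[OF i]])
      have "y i = \<sigma> N i \<ominus>\<^bsub>V i\<^esub> (\<sigma> N i \<ominus>\<^bsub>V i\<^esub> y i)"
        using y(1)[OF i] \<sigma>i[OF i] by (simp add: a_minus_def M.minus_add M.minus_minus M.a_assoc[symmetric] M.r_neg)
      then show "nrm (V i) (y i) \<le> nrm (V i) (\<sigma> N i) + ndist (V i) (\<sigma> N i) (y i)"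
        using nrm_diff_le[of "\<sigma> N i" "\<sigma> N i \<ominus>\<^bsub>V i\<^esub> y i"] y(1)[OF i] \<sigma>i[OF i] by (simp add: ndist_eq)
    qed
    then have yL: "y \<in> carrier (l1_sum I V)" using y(1) by (simp add: l1_sum_simps y_def)
    have "\<forall>\<^sub>F n in sequentially. ndist (l1_sum I V) (\<sigma> n) y < e" if e: "e > 0" for e
    proof -
      obtain N where N: "\<And>n F. n \<ge> N \<Longrightarrow> finite F \<Longrightarrow> F \<subseteq> I \<Longrightarrow> (\<Sum>i\<in>F. ndist (V i) (\<sigma> n i) (y i)) \<le> e / 2"
        using ev_le[of "e / 2"] e by auto
      have "ndist (l1_sum I V) (\<sigma> n) y \<le> e / 2" if "n \<ge> N" for n
        unfolding ndist_l1_sum(1)[OF \<sigma> yL]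
        using ndist_l1_sum(2)[OF \<sigma> yL] N[OF that] by (intro infsum_le_finite_sums) auto
      then show ?thesis using e by (force simp: eventually_sequentially)
    qed
    then have "limitin LM.mtopology \<sigma> y sequentially"
      using \<sigma> yL by (simp add: LM.limitin_metric)
    then show "\<exists>y. limitin LM.mtopology \<sigma> y sequentially" by blast
  qed
  then show ?thesis
    by (intro banach_space.intro banach_space_axioms.intro L.normed_vector_space_axioms)
qed


section \<open>Gliding hump\<close>

lemma infsum_Diff_finite:
  fixes p :: "'i \<Rightarrow> real"
  assumes "p summable_on J" "finite G" "G \<subseteq> J"
  shows "infsum p J = sum p G + infsum p (J - G)"
  using infsum_Un_disjoint[of p G "J - G"] summable_on_subset_banach[OF assms(1), of "J - G"] assms
  by (simp add: Un_absorb1)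

text \<open>
  The set \<open>T\<close> in the proof consists of the bounds \<open>t\<close> for the mass outside some finite set along
  some subsequence. If \<open>F\<close> and \<open>s\<close> come within \<open>e / 2\<close> of its infimum, then removing further
  coordinates can eventually reduce the mass by at most \<open>e\<close>, for otherwise a further subsequence
  would fall below the infimum. The conclusion persists for subsequences of \<open>s\<close>.
\<close>

lemma essential_finite_part:
  fixes p :: "nat \<Rightarrow> 'i \<Rightarrow> real"
  assumes p: "\<And>n i. i \<in> I \<Longrightarrow> 0 \<le> p n i" "\<And>n. p n summable_on I" "\<And>n. infsum (p n) I \<le> B"
    and e: "e > 0"
  shows "\<exists>F s. finite F \<and> F \<subseteq> I \<and> strict_mono (s :: nat \<Rightarrow> nat) \<and>
           (\<forall>G. finite G \<longrightarrow> G \<subseteq> I - F \<longrightarrow> (\<forall>\<^sub>F n in sequentially. sum (p (s n)) G \<le> e))"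
proof -
  define T where "T = {t. \<exists>F s. finite F \<and> F \<subseteq> I \<and> strict_mono (s :: nat \<Rightarrow> nat) \<and>
                          (\<forall>n. infsum (p (s n)) (I - F) \<le> t)}"
  have "B \<in> T"
    unfolding T_def mem_Collect_eq using p(3)
    by (intro exI[of _ "{}"] exI[of _ "id :: nat \<Rightarrow> nat"]) (simp add: strict_mono_id)
  have "0 \<le> t" if t: "t \<in> T" for t
  proof -
    obtain F and s :: "nat \<Rightarrow> nat" where "\<forall>n. infsum (p (s n)) (I - F) \<le> t"
      using t unfolding T_def by blast
    then have "infsum (p (s 0)) (I - F) \<le> t" by blast
    moreover have "0 \<le> infsum (p (s 0)) (I - F)" using p(1) by (intro infsum_nonneg) auto
    ultimately show ?thesis by simp
  qed
  then have bdd: "bdd_below T" by (auto simp: bdd_below_def)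
  have "\<exists>t\<in>T. t < Inf T + e / 2"
    using cInf_lessD[of T "Inf T + e / 2"] \<open>B \<in> T\<close> e by auto
  then obtain t F and s :: "nat \<Rightarrow> nat" where t: "t < Inf T + e / 2" and F: "finite F" "F \<subseteq> I"
    and s: "strict_mono s" and le: "\<And>n. infsum (p (s n)) (I - F) \<le> t"
    unfolding T_def by blast
  have "\<forall>\<^sub>F n in sequentially. sum (p (s n)) G \<le> e" if G: "finite G" "G \<subseteq> I - F" for G
  proof -
    have "\<forall>\<^sub>F n in sequentially. Inf T - e / 2 < infsum (p (s n)) (I - F - G)"
    proof (rule ccontr)
      assume "\<not> ?thesis"
      then have "\<And>N. \<exists>n\<ge>N. infsum (p (s n)) (I - F - G) \<le> Inf T - e / 2"
        by (auto simp: eventually_sequentially not_less)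
      then obtain r :: "nat \<Rightarrow> nat" where r: "strict_mono r"
          "\<And>n. infsum (p (s (r n))) (I - F - G) \<le> Inf T - e / 2"
        using frequently_subseq[of "\<lambda>n. infsum (p (s n)) (I - F - G) \<le> Inf T - e / 2"] by blast
      have T_I: "a \<in> T" if "finite H" "H \<subseteq> I" "strict_mono q" "\<And>n. infsum (p (q n)) (I - H) \<le> a"
        for a H and q :: "nat \<Rightarrow> nat"
        using that unfolding T_def by blast
      have "Inf T - e / 2 \<in> T"
      proof (rule T_I[where q = "s \<circ> r"])
        have "I - (F \<union> G) = I - F - G" by blast
        then show "infsum (p ((s \<circ> r) n)) (I - (F \<union> G)) \<le> Inf T - e / 2" for n
          using r(2)[of n] by simp
      qed (use F G strict_mono_o[OF s r(1)] in auto)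
      then show False using cInf_lower[OF _ bdd, of "Inf T - e / 2"] e by simp
    qed
    then show ?thesis
    proof eventually_elim
      case (elim n)
      have "infsum (p (s n)) (I - F) = sum (p (s n)) G + infsum (p (s n)) (I - F - G)"
        by (rule infsum_Diff_finite[OF summable_on_subset_banach[OF p(2)] G]) blast
      with elim le[of n] t show ?case by linarith
    qed
  qed
  with F s show ?thesis by blast
qed

text \<open>
  The recursion builds pairs of an index and a finite set \<open>A k\<close>. The next index is so large
  that the mass on \<open>A k\<close> is small, and \<open>A (Suc k)\<close> then captures nearly all of the mass;
  the hump is \<open>G k = A (Suc k) - A k\<close>.
\<close>

lemma gliding_hump:
  fixes p :: "nat \<Rightarrow> 'i \<Rightarrow> real"
  assumes p: "\<And>n i. i \<in> J \<Longrightarrow> 0 \<le> p n i" "\<And>n. p n summable_on J"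
    and null: "\<And>G. finite G \<Longrightarrow> G \<subseteq> J \<Longrightarrow> \<forall>\<^sub>F n in sequentially. sum (p n) G \<le> e"
    and e: "e > 0"
  shows "\<exists>(s :: nat \<Rightarrow> nat) G. strict_mono s \<and> disjoint_family G \<and>
           (\<forall>k. finite (G k) \<and> G k \<subseteq> J \<and> infsum (p (s k)) (J - G k) \<le> 2 * e)"
proof -
  \<comment> \<open>\<open>P\<close> and \<open>Q\<close> are the invariant and the step relation; neither depends on the stage.\<close>
  define P :: "nat \<Rightarrow> nat \<times> 'i set \<Rightarrow> bool"
    where "P = (\<lambda>_ x. finite (snd x) \<and> snd x \<subseteq> J)"
  define Q :: "nat \<Rightarrow> nat \<times> 'i set \<Rightarrow> nat \<times> 'i set \<Rightarrow> bool"
    where "Q = (\<lambda>_ x y. fst x < fst y \<and> snd x \<subseteq> snd y \<and> sum (p (fst y)) (snd x) \<le> e \<and>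
                        infsum (p (fst y)) (J - snd y) \<le> e)"
  have "\<exists>x. P 0 x" by (auto simp: P_def)
  moreover have "\<exists>y. P (Suc k) y \<and> Q k x y" if "P k x" for x k
  proof -
    obtain m A where x: "x = (m, A)" by (cases x)
    have A: "finite A" "A \<subseteq> J" using that by (auto simp: P_def x)
    obtain N where N: "\<And>n. n \<ge> N \<Longrightarrow> sum (p n) A \<le> e"
      using null[OF A] by (auto simp: eventually_sequentially)
    define n where "n = max N (Suc m)"
    obtain H where H: "finite H" "H \<subseteq> J" "dist (sum (p n) H) (infsum (p n) J) \<le> e"
      using infsum_finite_approximation[OF p(2) e] by blast
    have "infsum (p n) J = sum (p n) (A \<union> H) + infsum (p n) (J - (A \<union> H))"
      using A H p(2) by (intro infsum_Diff_finite) auto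
    moreover have "sum (p n) H \<le> sum (p n) (A \<union> H)"
      using A H p(1) by (intro sum_mono2) auto
    ultimately have "infsum (p n) (J - (A \<union> H)) \<le> e"
      using H(3) by (simp add: dist_real_def)
    then show ?thesis
      using A H N[of n] by (intro exI[of _ "(n, A \<union> H)"]) (auto simp: P_def Q_def x n_def)
  qed
  ultimately obtain f where f: "\<And>k. P k (f k)" "\<And>k. Q k (f k) (f (Suc k))"
    using dependent_nat_choice[of P Q] by blast
  define A where "A k = snd (f k)" for k
  define s where "s k = fst (f (Suc k))" for k
  define G where "G k = A (Suc k) - A k" for k
  have A: "finite (A k)" "A k \<subseteq> J" "A k \<subseteq> A (Suc k)" "sum (p (s k)) (A k) \<le> e"
      "infsum (p (s k)) (J - A (Suc k)) \<le> e" for k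
    using f(1)[of k] f(2)[of k] by (auto simp: P_def Q_def A_def s_def)
  have "strict_mono s"
    using f(2) by (auto simp: strict_mono_Suc_iff s_def Q_def)
  moreover have "disjoint_family G"
  proof -
    have mono: "A k \<subseteq> A l" if "k \<le> l" for k l using A(3) that by (rule lift_Suc_mono_le)
    have "G k \<inter> G l = {}" if "k < l" for k l
      using mono[of "Suc k" l] that by (auto simp: G_def)
    then show ?thesis
      unfolding disjoint_family_on_def by (metis Int_commute linorder_neqE_nat)
  qed
  moreover have "finite (G k)" "G k \<subseteq> J" for k using A[of "Suc k"] by (auto simp: G_def)
  moreover have "infsum (p (s k)) (J - G k) \<le> 2 * e" for k
  proof -
    have "infsum (p (s k)) (J - G k) = sum (p (s k)) (A k) + infsum (p (s k)) (J - G k - A k)"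
    proof (rule infsum_Diff_finite)
      show "p (s k) summable_on (J - G k)" by (rule summable_on_subset_banach[OF p(2)]) blast
      show "A k \<subseteq> J - G k" using A(2) by (auto simp: G_def)
    qed (rule A(1))
    also have "J - G k - A k = J - A (Suc k)" using A(3)[of k] by (auto simp: G_def)
    finally show ?thesis using A(4,5)[of k] by linarith
  qed
  ultimately show ?thesis by blast
qed

section \<open>Functionals on l1-sums\<close>

lemma bounded_seq_subseq: "bounded_seq V u \<Longrightarrow> bounded_seq V (\<lambda>n. u (s n))"
  unfolding bounded_seq_def by (auto simp: bdd_above_def)

text \<open>
  The functionals for all coordinates in \<open>F\<close> share one subsequence and their errors sum to at
  most \<open>e\<close>.
\<close>

lemma aligned_norming_finite:
  fixes V :: "'i \<Rightarrow> ('k::real_normed_field, 'a) normed_module"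
  assumes "finite F" and "\<And>i. i \<in> F \<Longrightarrow> aligned_norming c (V i)"
    and "\<And>i. i \<in> F \<Longrightarrow> bounded_seq (V i) (\<lambda>n. u n i)" and "e > 0"
  shows "\<exists>f s. strict_mono (s :: nat \<Rightarrow> nat) \<and> (\<forall>i\<in>F. f i \<in> dual_ball (V i)) \<and>
           (\<forall>n. (\<Sum>i\<in>F. norm (f i (u (s n) i) - of_real (nrm (V i) (u (s n) i) / c))) \<le> e)"
  using assms
proof (induction F arbitrary: e rule: finite_induct)
  case empty
  have "strict_mono (id :: nat \<Rightarrow> nat)" by (rule strict_mono_id)
  then show ?case using empty by auto
next
  case (insert j F)
  have "\<exists>f s. strict_mono (s :: nat \<Rightarrow> nat) \<and> (\<forall>i\<in>F. f i \<in> dual_ball (V i)) \<and>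
           (\<forall>n. (\<Sum>i\<in>F. norm (f i (u (s n) i) - of_real (nrm (V i) (u (s n) i) / c))) \<le> e / 2)"
    by (rule insert.IH) (use insert.prems in auto)
  then obtain f and s :: "nat \<Rightarrow> nat" where s: "strict_mono s" and f: "\<And>i. i \<in> F \<Longrightarrow> f i \<in> dual_ball (V i)"
    and fe: "\<And>n. (\<Sum>i\<in>F. norm (f i (u (s n) i) - of_real (nrm (V i) (u (s n) i) / c))) \<le> e / 2"
    by blast
  have bs: "bounded_seq (V j) (\<lambda>n. u (s n) j)"
    using bounded_seq_subseq[OF insert.prems(2)[of j]] by simp
  have "aligned_norming c (V j)" "e / 2 > 0" using insert.prems by auto
  from this(1)[unfolded aligned_norming_def, rule_format, OF bs this(2)]
  obtain g and r :: "nat \<Rightarrow> nat" where g: "g \<in> dual_ball (V j)" and r: "strict_mono r"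
    and ge: "\<And>n. norm (g (u (s (r n)) j) - of_real (nrm (V j) (u (s (r n)) j) / c)) \<le> e / 2"
    by blast
  have "(\<Sum>i\<in>insert j F. norm ((f(j := g)) i (u ((s \<circ> r) n) i) - of_real (nrm (V i) (u ((s \<circ> r) n) i) / c))) \<le> e" for n
  proof -
    have "(\<Sum>i\<in>F. norm ((f(j := g)) i (u ((s \<circ> r) n) i) - of_real (nrm (V i) (u ((s \<circ> r) n) i) / c)))
        = (\<Sum>i\<in>F. norm (f i (u (s (r n)) i) - of_real (nrm (V i) (u (s (r n)) i) / c)))"
      using insert.hyps by (intro sum.cong) auto
    then show ?thesis
      using fe[of "r n"] ge[of n] insert.hyps by simp
  qed
  moreover have "\<forall>i\<in>insert j F. (f(j := g)) i \<in> dual_ball (V i)" using f g by auto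
  ultimately show ?case using strict_mono_o[OF s r] by blast
qed

lemma l1_functional_in_dual_ball:
  fixes V :: "'i \<Rightarrow> ('k::{real_normed_field, banach}, 'a) normed_module"
  assumes V: "\<And>i. i \<in> I \<Longrightarrow> normed_vector_space (V i)"
    and h: "\<And>i. i \<in> I \<Longrightarrow> h i \<in> dual_ball (V i)"
  shows "(\<lambda>x. \<Sum>\<^sub>\<infinity>i\<in>I. h i (x i)) \<in> dual_ball (l1_sum I V)"
    and "x \<in> carrier (l1_sum I V) \<Longrightarrow> (\<lambda>i. norm (h i (x i))) summable_on I"
proof -
  interpret normed_family I V by (rule normed_family.intro) (rule V)
  interpret L: normed_vector_space "l1_sum I V" by (rule normed_vector_space_l1_sum)
  have le: "norm (h i (x i)) \<le> nrm (V i) (x i)" if "x \<in> carrier (l1_sum I V)" "i \<in> I" for x i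
    using normed_vector_space.dual_ball_le[OF V h] that by (auto simp: l1_sum_simps)
  show abs: "(\<lambda>i. norm (h i (x i))) summable_on I" if x: "x \<in> carrier (l1_sum I V)" for x
    by (rule Infinite_Sum.abs_summable_on_comparison_test'[OF _ le[OF x]]) (use x in \<open>simp add: l1_sum_simps\<close>)
  note summ = Infinite_Sum.abs_summable_summable[OF abs]
  show "(\<lambda>x. \<Sum>\<^sub>\<infinity>i\<in>I. h i (x i)) \<in> dual_ball (l1_sum I V)"
  proof (rule L.dual_ballI)
    fix x y assume xy: "x \<in> carrier (l1_sum I V)" "y \<in> carrier (l1_sum I V)"
    have "(\<Sum>\<^sub>\<infinity>i\<in>I. h i ((x \<oplus>\<^bsub>l1_sum I V\<^esub> y) i)) = (\<Sum>\<^sub>\<infinity>i\<in>I. h i (x i) + h i (y i))"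
      using xy normed_vector_space.dual_ball_add[OF V h] by (intro infsum_cong) (simp add: l1_sum_simps)
    then show "(\<Sum>\<^sub>\<infinity>i\<in>I. h i ((x \<oplus>\<^bsub>l1_sum I V\<^esub> y) i)) = (\<Sum>\<^sub>\<infinity>i\<in>I. h i (x i)) + (\<Sum>\<^sub>\<infinity>i\<in>I. h i (y i))"
      using infsum_add[OF summ[OF xy(1)] summ[OF xy(2)]] by simp
  next
    fix a x assume x: "x \<in> carrier (l1_sum I V)"
    have "(\<Sum>\<^sub>\<infinity>i\<in>I. h i ((a \<odot>\<^bsub>l1_sum I V\<^esub> x) i)) = (\<Sum>\<^sub>\<infinity>i\<in>I. a * h i (x i))"
      using x normed_vector_space.dual_ball_scale[OF V h] by (intro infsum_cong) (simp add: l1_sum_simps)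
    then show "(\<Sum>\<^sub>\<infinity>i\<in>I. h i ((a \<odot>\<^bsub>l1_sum I V\<^esub> x) i)) = a * (\<Sum>\<^sub>\<infinity>i\<in>I. h i (x i))"
      by (simp add: infsum_cmult_right')
  next
    fix x assume x: "x \<in> carrier (l1_sum I V)"
    have "norm (\<Sum>\<^sub>\<infinity>i\<in>I. h i (x i)) \<le> (\<Sum>\<^sub>\<infinity>i\<in>I. norm (h i (x i)))"
      by (rule norm_infsum_bound[OF abs[OF x]])
    also have "\<dots> \<le> nrm (l1_sum I V) x"
      unfolding l1_sum_simps(5) using x le[OF x] abs[OF x] by (intro infsum_mono) (auto simp: l1_sum_simps)
    finally show "norm (\<Sum>\<^sub>\<infinity>i\<in>I. h i (x i)) \<le> nrm (l1_sum I V) x" .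
  qed
qed

text \<open>
  If \<open>x\<close> is nearly supported in \<open>E\<close>, then errors in the coordinates outside \<open>E\<close> are negligible:
  each is at most \<open>(1 + 1 / c) \<parallel>x i\<parallel> \<le> 2 \<parallel>x i\<parallel>\<close>.
\<close>

lemma l1_functional_error:
  fixes V :: "'i \<Rightarrow> ('k::{real_normed_field, banach}, 'a) normed_module"
  assumes V: "\<And>i. i \<in> I \<Longrightarrow> normed_vector_space (V i)"
    and h: "\<And>i. i \<in> I \<Longrightarrow> h i \<in> dual_ball (V i)" and c: "c \<ge> 1"
    and x: "x \<in> carrier (l1_sum I V)"
    and E: "finite E" "E \<subseteq> I"
    and errE: "(\<Sum>i\<in>E. norm (h i (x i) - of_real (nrm (V i) (x i) / c))) \<le> a"
    and tail: "(\<Sum>\<^sub>\<infinity>i\<in>I - E. nrm (V i) (x i)) \<le> b"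
  shows "norm ((\<Sum>\<^sub>\<infinity>i\<in>I. h i (x i)) - of_real (nrm (l1_sum I V) x / c)) \<le> a + 2 * b"
proof -
  interpret normed_family I V by (rule normed_family.intro) (rule V)
  let ?p = "\<lambda>i. nrm (V i) (x i)"
  let ?q = "\<lambda>i. h i (x i) - of_real (?p i / c)"
  have p0: "0 \<le> ?p i" if "i \<in> I" for i by (rule coordinate_nrm_nonneg[OF x that])
  have p: "?p summable_on I" using x by (simp add: l1_sum_simps)
  have q_le: "norm (?q i) \<le> 2 * ?p i" if i: "i \<in> I" for i
  proof -
    have "norm (?q i) \<le> norm (h i (x i)) + norm (of_real (?p i / c) :: 'k)" by (rule norm_triangle_ineq4)
    also have "\<dots> \<le> ?p i + ?p i"
    proof (rule add_mono)
      show "norm (h i (x i)) \<le> ?p i"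
        using normed_vector_space.dual_ball_le[OF V[OF i] h[OF i]] x i by (simp add: l1_sum_simps)
      show "norm (of_real (?p i / c) :: 'k) \<le> ?p i"
        using p0[OF i] c mult_left_mono[of 1 c "?p i"] by (simp only: norm_of_real) (simp add: divide_le_eq)
    qed
    finally show ?thesis by simp
  qed
  have p2: "(\<lambda>i. 2 * ?p i) summable_on I" using p by (rule summable_on_cmult_right)
  have q: "(\<lambda>i. norm (?q i)) summable_on I"
    by (rule Infinite_Sum.abs_summable_on_comparison_test'[OF p2 q_le])
  have pc: "((\<lambda>i. ?p i * (- 1 / c)) has_sum (infsum ?p I * (- 1 / c))) I"
    by (intro has_sum_cmult_left has_sum_infsum p)
  have pc': "((\<lambda>i. - of_real (?p i / c) :: 'k) has_sum - of_real (infsum ?p I / c)) I"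
  proof -
    have "(of_real (t * (- 1 / c)) :: 'k) = - of_real (t / c)" for t
      unfolding of_real_minus[symmetric] by simp
    with has_sum_of_real[OF pc, where 'a = 'k] show ?thesis by (simp only:)
  qed
  have "((\<lambda>i. h i (x i)) has_sum (\<Sum>\<^sub>\<infinity>i\<in>I. h i (x i))) I"
    by (rule has_sum_infsum[OF Infinite_Sum.abs_summable_summable[OF l1_functional_in_dual_ball(2)[OF V h x]]])
  from has_sum_add[OF this pc']
  have "(\<Sum>\<^sub>\<infinity>i\<in>I. h i (x i)) - of_real (nrm (l1_sum I V) x / c) = infsum ?q I"
    by (simp add: infsumI l1_sum_simps)
  then have "norm ((\<Sum>\<^sub>\<infinity>i\<in>I. h i (x i)) - of_real (nrm (l1_sum I V) x / c)) \<le> (\<Sum>\<^sub>\<infinity>i\<in>I. norm (?q i))"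
    using norm_infsum_bound[OF q] by simp
  also have "\<dots> = (\<Sum>i\<in>E. norm (?q i)) + (\<Sum>\<^sub>\<infinity>i\<in>I - E. norm (?q i))"
    using q E by (rule infsum_Diff_finite)
  also have "(\<Sum>\<^sub>\<infinity>i\<in>I - E. norm (?q i)) \<le> (\<Sum>\<^sub>\<infinity>i\<in>I - E. 2 * ?p i)"
    using summable_on_subset_banach[OF q] summable_on_subset_banach[OF p2] q_le by (intro infsum_mono) auto
  also have "\<dots> \<le> 2 * b" using tail by (simp add: infsum_cmult_right')
  finally show ?thesis using errE by simp
qed

lemma aligned_norming_l1_sum:
  fixes V :: "'i \<Rightarrow> ('k::{real_normed_field, banach}, 'a) normed_module"
  assumes c: "c \<ge> 1" and V: "\<And>i. i \<in> I \<Longrightarrow> normed_vector_space (V i)"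
    and al: "\<And>i. i \<in> I \<Longrightarrow> aligned_norming c (V i)"
  shows "aligned_norming c (l1_sum I V)"
  unfolding aligned_norming_def
proof (intro allI impI)
  fix u and e0 :: real assume u: "bounded_seq (l1_sum I V) u" and e0: "e0 > 0"
  interpret normed_family I V by (rule normed_family.intro) (rule V)
  interpret L: normed_vector_space "l1_sum I V" by (rule normed_vector_space_l1_sum)
  \<comment> \<open>The total error is \<open>e\<close> on \<open>F\<close>, \<open>e\<close> on the hump, and twice the remaining mass \<open>2 * e\<close>.\<close>
  define e where "e = e0 / 6"
  have e: "e > 0" using e0 by (simp add: e_def)
  obtain B where "B > 0" and B: "\<And>n. u n \<in> carrier (l1_sum I V)" "\<And>n. nrm (l1_sum I V) (u n) \<le> B"
    by (rule L.bounded_seqE[OF u]) blast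
  have bc: "bounded_seq (V i) (\<lambda>n. u n i)" if i: "i \<in> I" for i
    using B(1) coordinate_nrm_le[OF B(1) i] B(2) i normed_vector_space.bounded_seqI[OF V[OF i], of "\<lambda>n. u n i" B]
    by (force simp: l1_sum_simps intro: order_trans)
  define p where "p = (\<lambda>n i. nrm (V i) (u n i))"
  have p: "\<And>n i. i \<in> I \<Longrightarrow> 0 \<le> p n i" "\<And>n. p n summable_on I" "\<And>n. infsum (p n) I \<le> B"
    using B coordinate_nrm_nonneg[OF B(1)] by (auto simp: p_def l1_sum_simps)
  obtain F and s1 :: "nat \<Rightarrow> nat" where F: "finite F" "F \<subseteq> I" and s1: "strict_mono s1" and
    small: "\<And>G. finite G \<Longrightarrow> G \<subseteq> I - F \<Longrightarrow> \<forall>\<^sub>F n in sequentially. sum (p (s1 n)) G \<le> e"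
    using essential_finite_part[of I p B e, OF p e] by blast
  have "\<exists>f s. strict_mono (s :: nat \<Rightarrow> nat) \<and> (\<forall>i\<in>F. f i \<in> dual_ball (V i)) \<and>
     (\<forall>n. (\<Sum>i\<in>F. norm (f i (u (s1 (s n)) i) - of_real (nrm (V i) (u (s1 (s n)) i) / c))) \<le> e)"
    using F e al bounded_seq_subseq[OF bc]
    by (intro aligned_norming_finite[where u = "\<lambda>n. u (s1 n)"]) auto
  then obtain f and s2 :: "nat \<Rightarrow> nat" where s2: "strict_mono s2" and f: "\<And>i. i \<in> F \<Longrightarrow> f i \<in> dual_ball (V i)"
    and fe: "\<And>n. (\<Sum>i\<in>F. norm (f i (u (s1 (s2 n)) i) - of_real (nrm (V i) (u (s1 (s2 n)) i) / c))) \<le> e"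
    by blast
  have "\<exists>(s :: nat \<Rightarrow> nat) G. strict_mono s \<and> disjoint_family G \<and>
          (\<forall>k. finite (G k) \<and> G k \<subseteq> I - F \<and> infsum (p (s1 (s2 (s k)))) (I - F - G k) \<le> 2 * e)"
  proof (rule gliding_hump[of "I - F" "\<lambda>n. p (s1 (s2 n))" e, OF _ _ _ e])
    fix G assume "finite G" "G \<subseteq> I - F"
    then show "\<forall>\<^sub>F n in sequentially. sum (p (s1 (s2 n))) G \<le> e"
      using eventually_subseq[OF s2 small] by blast
  qed (use p in \<open>auto intro: summable_on_subset_banach\<close>)
  then obtain s3 :: "nat \<Rightarrow> nat" and G where s3: "strict_mono s3" and disj: "disjoint_family G"
    and G: "\<And>k. finite (G k)" "\<And>k. G k \<subseteq> I - F"
    and tail: "\<And>k. infsum (p (s1 (s2 (s3 k)))) (I - F - G k) \<le> 2 * e"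
    by blast
  define v where "v k = u (s1 (s2 (s3 k)))" for k
  have v: "v k \<in> carrier (l1_sum I V)" for k using B(1) by (simp add: v_def)
  \<comment> \<open>Constant sequences make the finite version into a statement about the single vector \<open>v k\<close>.\<close>
  have "\<exists>g. (\<forall>i\<in>G k. g i \<in> dual_ball (V i)) \<and>
            (\<Sum>i\<in>G k. norm (g i (v k i) - of_real (nrm (V i) (v k i) / c))) \<le> e" for k
  proof -
    have "bounded_seq (V i) (\<lambda>_. v k i)" if "i \<in> G k" for i
      using v[of k] that G(2)[of k] by (auto simp: bounded_seq_def l1_sum_simps)
    moreover have "aligned_norming c (V i)" if "i \<in> G k" for i using al that G(2)[of k] by blast
    ultimately have "\<exists>f s. strict_mono (s :: nat \<Rightarrow> nat) \<and> (\<forall>i\<in>G k. f i \<in> dual_ball (V i)) \<and>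
           (\<forall>n::nat. (\<Sum>i\<in>G k. norm (f i (v k i) - of_real (nrm (V i) (v k i) / c))) \<le> e)"
      using G(1)[of k] e by (intro aligned_norming_finite[where u = "\<lambda>_. v k"]) auto
    then show ?thesis by blast
  qed
  then have "\<forall>k. \<exists>g. (\<forall>i\<in>G k. g i \<in> dual_ball (V i)) \<and>
            (\<Sum>i\<in>G k. norm (g i (v k i) - of_real (nrm (V i) (v k i) / c))) \<le> e" by blast
  from choice[OF this] obtain g where
    g_all: "\<forall>k. (\<forall>i\<in>G k. g k i \<in> dual_ball (V i)) \<and>
            (\<Sum>i\<in>G k. norm (g k i (v k i) - of_real (nrm (V i) (v k i) / c))) \<le> e" ..
  have g: "g k i \<in> dual_ball (V i)" if "i \<in> G k" for k i using g_all that by blast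
  have ge: "(\<Sum>i\<in>G k. norm (g k i (v k i) - of_real (nrm (V i) (v k i) / c))) \<le> e" for k
    using g_all by blast
  define h where "h i = (if i \<in> F then f i else if \<exists>k. i \<in> G k then g (THE k. i \<in> G k) i else (\<lambda>_. 0))" for i
  have h_G: "h i = g k i" if "i \<in> G k" for i k
  proof -
    have "(THE k. i \<in> G k) = k"
      using that disj by (intro the_equality) (auto simp: disjoint_family_on_def)
    then show ?thesis using that G(2)[of k] by (auto simp: h_def)
  qed
  have h: "h i \<in> dual_ball (V i)" if "i \<in> I" for i
  proof -
    consider "i \<in> F" | k where "i \<in> G k" | "i \<notin> F" "\<And>k. i \<notin> G k" by blast
    then show ?thesis
    proof cases
      case 1
      then show ?thesis using f by (simp add: h_def)
    next
      case (2 k)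
      then show ?thesis using g h_G by simp
    next
      case 3
    then show ?thesis using normed_vector_space.zero_in_dual_ball[OF V[OF that]] by (simp add: h_def)
    qed
  qed
  have "norm ((\<Sum>\<^sub>\<infinity>i\<in>I. h i (v k i)) - of_real (nrm (l1_sum I V) (v k) / c)) \<le> 2 * e + 2 * (2 * e)" for k
  proof (rule l1_functional_error[OF V h c v])
    show "finite (F \<union> G k)" "F \<union> G k \<subseteq> I" using F G[of k] by auto
    have "(\<Sum>i\<in>F \<union> G k. norm (h i (v k i) - of_real (nrm (V i) (v k i) / c))) =
        (\<Sum>i\<in>F. norm (h i (v k i) - of_real (nrm (V i) (v k i) / c))) +
        (\<Sum>i\<in>G k. norm (h i (v k i) - of_real (nrm (V i) (v k i) / c)))"
      using F G[of k] by (intro sum.union_disjoint) auto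
    also have "(\<Sum>i\<in>F. norm (h i (v k i) - of_real (nrm (V i) (v k i) / c))) \<le> e"
      using fe[of "s3 k"] by (simp add: h_def v_def)
    also have "(\<Sum>i\<in>G k. norm (h i (v k i) - of_real (nrm (V i) (v k i) / c))) \<le> e"
      using ge[of k] by (simp add: h_G)
    finally show "(\<Sum>i\<in>F \<union> G k. norm (h i (v k i) - of_real (nrm (V i) (v k i) / c))) \<le> 2 * e" by simp
    show "(\<Sum>\<^sub>\<infinity>i\<in>I - (F \<union> G k). nrm (V i) (v k i)) \<le> 2 * e"
      using tail[of k] by (simp add: p_def v_def Diff_Un Diff_Diff_Int set_diff_eq conj_assoc)
  qed
  moreover have "strict_mono (\<lambda>k. s1 (s2 (s3 k)))" using s1 s2 s3 by (simp add: strict_mono_def)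
  ultimately show "\<exists>f\<in>dual_ball (l1_sum I V). \<exists>s :: nat \<Rightarrow> nat. strict_mono s \<and>
           (\<forall>n. norm (f (u (s n)) - of_real (nrm (l1_sum I V) (u (s n)) / c)) \<le> e0)"
    using l1_functional_in_dual_ball(1)[OF V h]
    by (intro bexI[of _ "\<lambda>x. \<Sum>\<^sub>\<infinity>i\<in>I. h i (x i)"] exI[of _ "\<lambda>k. s1 (s2 (s3 k))"]) (auto simp: v_def e_def)
qed

text \<open>
  The scalar field only has to be complete with convergent subsequences of bounded sequences,
  which covers the real and the complex case at once.
\<close>

lemma Schur_property_l1_sum:
  fixes V :: "'i \<Rightarrow> ('k::{real_normed_field, banach, heine_borel}, 'a) normed_module"
  assumes c: "c \<ge> 1" and V: "\<And>i. i \<in> I \<Longrightarrow> Schur_property c (V i)"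
  shows "Schur_property c (l1_sum I V)"
proof (rule aligned_norming_imp_Schur)
  have banach: "banach_space (V i)" if "i \<in> I" for i
    using V[OF that] by (simp add: Schur_property_def)
  then show "banach_space (l1_sum I V)" by (rule banach_space_l1_sum)
  show "aligned_norming c (l1_sum I V)"
    using c V by (intro aligned_norming_l1_sum banach_space.axioms(1)[OF banach] Schur_imp_aligned_norming) auto
qed (use c in simp)

theorem theorem7p4:
  fixes c :: real and I :: "'i set"
    and V :: "'i \<Rightarrow> (real, 'a) normed_module"
    and W :: "'i \<Rightarrow> (complex, 'a) normed_module"
  assumes "c \<ge> 1"
  shows "((\<forall>i\<in>I. Schur_property c (V i)) \<longrightarrow> Schur_property c (l1_sum I V)) \<and>
         ((\<forall>i\<in>I. Schur_property c (W i)) \<longrightarrow> Schur_property c (l1_sum I W))"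
  using Schur_property_l1_sum[OF assms, of I V] Schur_property_l1_sum[OF assms, of I W] by blast

end
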